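(* Let $q,t\in[0,1)$, $a_1,\dots,a_N>0$, and fix $k\in\{2,\dots,N\}$. Let real parameters $r_j(\bar\nu,\lambda),c_j(\bar\nu,\lambda)$ ($j+1\in\mathscr F(\bar\nu,\lambda)$) and $w_m(\bar\nu,\lambda)$ ($m\in\mathscr F(\bar\nu,\lambda)$) be given for all $\bar\nu\in\mathbb{GT}_{k-1},\lambda\in\mathbb{GT}_k$ with $\bar\nu\prec\lambda$. They correspond to a multivariate `dynamics' on the slice of levels $k-1,k$ if and only if for every pair $\bar\nu\prec\lambda$ they satisfy the system of linear equations (dependence on $(\bar\nu,\lambda)$ omitted) $$\begin{cases} r_{j_2}T_{j_2}+w_{j_1+1}=S_{j_1+1};\\ r_{j_{m+1}}T_{j_{m+1}}+(c_{j_m}-r_{j_m})T_{j_m}+w_{j_m+1}=S_{j_m+1},\quad m=2,\dots,\kappa-1;\\ (c_{j_\kappa}-r_{j_\kappa})T_{j_\kappa}+w_{j_\kappa+1}=S_{j_\kappa+1},\end{cases}$$ where $\mathscr F(\bar\nu,\lambda)=\{j_1+1<j_2+1<\dots<j_\kappa+1\}$, $j_1=0$ (for $\kappa=1$ the system is the single equation $w_1=S_1$).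
   Context: **Signatures.** $\mathbb{GT}_k=\{\lambda\in\mathbb Z^k:\lambda_1\ge\dots\ge\lambda_k\}$, $\mathbb{GT}_0=\{\varnothing\}$, $|\lambda|=\sum\lambda_i$. $\bar\lambda\prec\lambda$ ($\bar\lambda\in\mathbb{GT}_{k-1},\lambda\in\mathbb{GT}_k$) means $\lambda_{i+1}\le\bar\lambda_i\le\lambda_i$, $1\le i\le k-1$. $\mathrm e_j$, $\bar{\mathrm e}_i$ are standard basis vectors of $\mathbb Z^k$, $\mathbb Z^{k-1}$. **Macdonald quantities.** $(a;q)_\infty=\prod_{i\ge0}(1-aq^i)$, $f(u)=(tu;q)_\infty/(qu;q)_\infty$, $0^0=1$. For $\kappa\prec\nu$, $\nu\in\mathbb{GT}_m$: $\psi_{\nu/\kappa}=\prod_{1\le i\le j\le m-1}\frac{f(q^{\kappa_i-\kappa_j}t^{j-i})f(q^{\nu_i-\nu_{j+1}}t^{j-i})}{f(q^{\nu_i-\kappa_j}t^{j-i})f(q^{\kappa_i-\nu_{j+1}}t^{j-i})}$; $\psi_{\nu/\kappa}=0$ if $\kappa\not\prec\nu$ or if one of them is not a signature. For signatures $\mu,\mu+\mathrm e_j$: $\psi'_{\mu+\mathrm e_j/\mu}=\prod_{i=1}^{j-1}\frac{(1-q^{\mu_i-\mu_j}t^{j-i-1})(1-q^{\mu_i-\mu_j-1}t^{j-i+1})}{(1-q^{\mu_i-\mu_j}t^{j-i})(1-q^{\mu_i-\mu_j-1}t^{j-i})}$ (zero if one of them is not a signature). $P_\lambda(a_1,\dots,a_k)=\sum_{\lambda^{(1)}\prec\dots\prec\lambda^{(k)}=\lambda}\prod_{i=1}^k\psi_{\lambda^{(i)}/\lambda^{(i-1)}}a_i^{|\lambda^{(i)}|-|\lambda^{(i-1)}|}$.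 $\Lambda^k_{k-1}(\lambda,\bar\lambda)=\frac{P_{\bar\lambda}(a_1,\dots,a_{k-1})}{P_\lambda(a_1,\dots,a_k)}\psi_{\lambda/\bar\lambda}a_k^{|\lambda|-|\bar\lambda|}$. $Q_k(\lambda,\lambda+\mathrm e_j)=\frac{P_{\lambda+\mathrm e_j}(a_1,\dots,a_k)}{P_\lambda(a_1,\dots,a_k)}\psi'_{\lambda+\mathrm e_j/\lambda}$, other off-diagonal entries $0$, $Q_k(\lambda,\lambda)=-\sum_{\nu\ne\lambda}Q_k(\lambda,\nu)$. For $\bar\nu\prec\lambda$: $T_i=\frac{\psi_{\lambda/\bar\nu-\bar{\mathrm e}_i}}{\psi_{\lambda/\bar\nu}}\psi'_{\bar\nu/\bar\nu-\bar{\mathrm e}_i}$, $S_j=\frac{\psi_{\lambda+\mathrm e_j/\bar\nu}}{\psi_{\lambda/\bar\nu}}\psi'_{\lambda+\mathrm e_j/\lambda}$. **Parametrization.** For $\bar\nu\prec\lambda$: $\mathscr F=\mathscr F(\bar\nu,\lambda)=\{j\in\{1,\dots,k\}:\lambda_j<\bar\nu_{j-1}\}$ ($\bar\nu_0=+\infty$), $\kappa=|\mathscr F|$, $\xi(i)=\max\{j\le i:j\in\mathscr F\}$. The parameters $(r,c,w)$ determine functions $W_k(\lambda,\nu|\bar\nu)$ (rates of independent jumps) and $V_k(\lambda,\nu|\bar\lambda,\bar\nu)$ (probabilities of triggered moves), of nearest neighbor type, as follows. For $\bar\nu\prec\lambda$, $m\in\mathscr F$ and $j+1\in\mathscr F$: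 $W_k(\lambda,\lambda+\mathrm e_m|\bar\nu)=a_kw_m$; $V_k(\lambda,\lambda+\mathrm e_{\xi(j)}|\bar\nu-\bar{\mathrm e}_j,\bar\nu)=r_j$; $V_k(\lambda,\lambda+\mathrm e_{j+1}|\bar\nu-\bar{\mathrm e}_j,\bar\nu)=c_j-r_j$; $V_k(\lambda,\lambda|\bar\nu-\bar{\mathrm e}_j,\bar\nu)=1-c_j$. If $\bar\nu\not\prec\lambda$, $\bar\nu-\bar{\mathrm e}_j\prec\lambda$, $\bar\nu\prec\lambda+\mathrm e_j$: $V_k(\lambda,\lambda+\mathrm e_j|\bar\nu-\bar{\mathrm e}_j,\bar\nu)=1$. Also $V_k(\lambda,\nu|\bar\nu,\bar\nu)=1_{\lambda=\nu}$, $W_k(\lambda,\lambda|\bar\nu)=-\sum_{\nu\ne\lambda}W_k(\lambda,\nu|\bar\nu)$; all other values are $0$. **`Dynamics' on the slice.** The parameters correspond to a multivariate `dynamics' (positivity not required) if for all $\lambda,\nu\in\mathbb{GT}_k$, $\bar\nu\in\mathbb{GT}_{k-1}$ with $\bar\nu\prec\nu$ $$\sum_{\bar\lambda}V_k(\lambda,\nu|\bar\lambda,\bar\nu)\Lambda^k_{k-1}(\lambda,\bar\lambda)Q_{k-1}(\bar\lambda,\bar\nu)+W_k(\lambda,\nu|\bar\nu)\Lambda^k_{k-1}(\lambda,\bar\nu)=Q_k(\lambda,\nu)\Lambda^k_{k-1}(\nu,\bar\nu).$$ *)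

theory Defs
  imports "HOL-Analysis.Analysis" "HOL-Library.Function_Algebras"
begin

text \<open>
  A vector of \<open>\<int>\<^sup>k\<close> is a function \<open>nat \<Rightarrow> int\<close> with coordinates at the indices \<open>1, \<dots>, k\<close> and value 0 at
  all other indices, so that equality of functions is equality of vectors. Since the same function
  may represent vectors of different lengths, the level \<open>k\<close> is always passed explicitly. Sums and
  differences of vectors are pointwise.
\<close>

definition GT :: "nat \<Rightarrow> (nat \<Rightarrow> int) set" where
  "GT k = {l. (\<forall>i. i \<notin> {1..k} \<longrightarrow> l i = 0) \<and> (\<forall>i\<in>{1..<k}. l (i + 1) \<le> l i)}"

definition e :: "nat \<Rightarrow> nat \<Rightarrow> int" where
  "e j = (\<lambda>i. if i = j then 1 else 0)"

definition weight :: "nat \<Rightarrow> (nat \<Rightarrow> int) \<Rightarrow> int" where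
  "weight k l = (\<Sum>i=1..k. l i)"

text \<open>\<open>interlace k b l\<close> is \<open>b \<prec> l\<close> with \<open>b\<close> at level \<open>k - 1\<close> and \<open>l\<close> at level \<open>k\<close>.\<close>

definition interlace :: "nat \<Rightarrow> (nat \<Rightarrow> int) \<Rightarrow> (nat \<Rightarrow> int) \<Rightarrow> bool" where
  "interlace k b l \<longleftrightarrow>
     b \<in> GT (k - 1) \<and> l \<in> GT k \<and> (\<forall>i\<in>{1..k - 1}. l (i + 1) \<le> b i \<and> b i \<le> l i)"

definition qpoch_inf :: "real \<Rightarrow> real \<Rightarrow> real" where
  "qpoch_inf x q = (\<Prod>i. 1 - x * q ^ i)"

definition f :: "real \<Rightarrow> real \<Rightarrow> real \<Rightarrow> real" where
  "f q t u = qpoch_inf (t * u) q / qpoch_inf (q * u) q"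

text \<open>
  Integer powers \<open>q powi n\<close> satisfy \<open>0 powi 0 = 1\<close>. Under the interlacing (respectively signature)
  conditions all exponents of \<open>q\<close> below are nonnegative and all denominators are nonzero.
\<close>

definition psi :: "real \<Rightarrow> real \<Rightarrow> nat \<Rightarrow> (nat \<Rightarrow> int) \<Rightarrow> (nat \<Rightarrow> int) \<Rightarrow> real" where
  "psi q t m nu ka =
     (if interlace m ka nu then
        \<Prod>(i, j)\<in>{(i, j). 1 \<le> i \<and> i \<le> j \<and> j \<le> m - 1}.
          (f q t (q powi (ka i - ka j) * t ^ (j - i)) *
           f q t (q powi (nu i - nu (j + 1)) * t ^ (j - i))) /
          (f q t (q powi (nu i - ka j) * t ^ (j - i)) *
           f q t (q powi (ka i - nu (j + 1)) * t ^ (j - i)))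
      else 0)"

text \<open>\<open>psi' q t k mu j\<close> is \<open>\<psi>'\<close> for the pair \<open>mu + e j / mu\<close> at level \<open>k\<close>.\<close>

definition psi' :: "real \<Rightarrow> real \<Rightarrow> nat \<Rightarrow> (nat \<Rightarrow> int) \<Rightarrow> nat \<Rightarrow> real" where
  "psi' q t k mu j =
     (if mu \<in> GT k \<and> mu + e j \<in> GT k then
        \<Prod>i\<in>{1..<j}.
          ((1 - q powi (mu i - mu j) * t ^ (j - i - 1)) *
           (1 - q powi (mu i - mu j - 1) * t ^ (j - i + 1))) /
          ((1 - q powi (mu i - mu j) * t ^ (j - i)) *
           (1 - q powi (mu i - mu j - 1) * t ^ (j - i)))
      else 0)"

definition GT_patterns :: "nat \<Rightarrow> (nat \<Rightarrow> int) \<Rightarrow> (nat \<Rightarrow> nat \<Rightarrow> int) set" where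
  "GT_patterns k l =
     {L \<in> (\<Pi>\<^sub>E i\<in>{0..k}. GT i). (\<forall>i\<in>{1..k}. interlace i (L (i - 1)) (L i)) \<and> L k = l}"

text \<open>The sum defining the Macdonald polynomial \<open>P\<close> ranges over a finite set.\<close>

lemma finite_GT_patterns: "finite (GT_patterns k l)"
proof (rule finite_subset)
  define B where "B = Max ((\<lambda>j. \<bar>l j\<bar>) ` {1..k})"
  have B: "\<bar>l j\<bar> \<le> B" if "j \<in> {1..k}" for j
    using that by (simp add: B_def)
  let ?D = "\<lambda>i::nat. {f. \<forall>x. (x \<in> {1..i} \<longrightarrow> f x \<in> {-B..B}) \<and> (x \<notin> {1..i} \<longrightarrow> f x = (0::int))}"
  show "finite (\<Pi>\<^sub>E i\<in>{0..k}. ?D i)"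
    by (intro finite_PiE finite_set_of_finite_funs) auto
  show "GT_patterns k l \<subseteq> (\<Pi>\<^sub>E i\<in>{0..k}. ?D i)"
  proof
    fix L assume "L \<in> GT_patterns k l"
    then have L: "L \<in> (\<Pi>\<^sub>E i\<in>{0..k}. GT i)" "L k = l"
      and int: "\<And>i. i \<in> {1..k} \<Longrightarrow> interlace i (L (i - 1)) (L i)"
      by (auto simp: GT_patterns_def)
    have bound: "\<forall>x\<in>{1..i}. \<bar>L i x\<bar> \<le> B" if "i \<le> k" for i
      using that
    proof (induction rule: inc_induct)
      case base
      then show ?case using B L by auto
    next
      case (step n)
      have "L (Suc n) (x + 1) \<le> L n x \<and> L n x \<le> L (Suc n) x" if "x \<in> {1..n}" for x
        using int[of "Suc n"] step.hyps that by (auto simp: interlace_def)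
      moreover have "\<bar>L (Suc n) (x + 1)\<bar> \<le> B \<and> \<bar>L (Suc n) x\<bar> \<le> B" if "x \<in> {1..n}" for x
        using step.IH that by auto
      ultimately show ?case by (smt (verit))
    qed
    have "L i \<in> ?D i" if "i \<in> {0..k}" for i
    proof -
      have "L i \<in> GT i" using L(1) that by (rule PiE_mem)
      then have "L i x = 0" if "x \<notin> {1..i}" for x using that unfolding GT_def by blast
      moreover have "L i x \<in> {-B..B}" if "x \<in> {1..i}" for x
        using bound[of i] that \<open>i \<in> {0..k}\<close> by (fastforce simp: abs_le_iff)
      ultimately show ?thesis by blast
    qed
    then show "L \<in> (\<Pi>\<^sub>E i\<in>{0..k}. ?D i)" using L(1) by (auto simp: PiE_iff)
  qed
qed

definition P :: "real \<Rightarrow> real \<Rightarrow> (nat \<Rightarrow> real) \<Rightarrow> nat \<Rightarrow> (nat \<Rightarrow> int) \<Rightarrow> real" where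
  "P q t a k l =
     (\<Sum>L\<in>GT_patterns k l. \<Prod>i=1..k.
        psi q t i (L i) (L (i - 1)) * a i powi (weight i (L i) - weight (i - 1) (L (i - 1))))"

definition Lambda ::
  "real \<Rightarrow> real \<Rightarrow> (nat \<Rightarrow> real) \<Rightarrow> nat \<Rightarrow> (nat \<Rightarrow> int) \<Rightarrow> (nat \<Rightarrow> int) \<Rightarrow> real" where
  "Lambda q t a k l b =
     P q t a (k - 1) b / P q t a k l * psi q t k l b * a k powi (weight k l - weight (k - 1) b)"

text \<open>
  The sum over \<open>j\<close> has at most one term. The sums over all signatures here and below have only
  finitely many nonzero terms, hence are ordinary finite sums.
\<close>

definition Q_off ::
  "real \<Rightarrow> real \<Rightarrow> (nat \<Rightarrow> real) \<Rightarrow> nat \<Rightarrow> (nat \<Rightarrow> int) \<Rightarrow> (nat \<Rightarrow> int) \<Rightarrow> real" where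
  "Q_off q t a k l n =
     (\<Sum>j | j \<in> {1..k} \<and> n = l + e j. P q t a k n / P q t a k l * psi' q t k l j)"

definition Q ::
  "real \<Rightarrow> real \<Rightarrow> (nat \<Rightarrow> real) \<Rightarrow> nat \<Rightarrow> (nat \<Rightarrow> int) \<Rightarrow> (nat \<Rightarrow> int) \<Rightarrow> real" where
  "Q q t a k l n =
     (if n = l then - (\<Sum>\<^sub>\<infinity>n'\<in>GT k - {l}. Q_off q t a k l n') else Q_off q t a k l n)"

definition T :: "real \<Rightarrow> real \<Rightarrow> nat \<Rightarrow> (nat \<Rightarrow> int) \<Rightarrow> (nat \<Rightarrow> int) \<Rightarrow> nat \<Rightarrow> real" where
  "T q t k nb l i = psi q t k l (nb - e i) / psi q t k l nb * psi' q t (k - 1) (nb - e i) i"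

definition S :: "real \<Rightarrow> real \<Rightarrow> nat \<Rightarrow> (nat \<Rightarrow> int) \<Rightarrow> (nat \<Rightarrow> int) \<Rightarrow> nat \<Rightarrow> real" where
  "S q t k nb l j = psi q t k (l + e j) nb / psi q t k l nb * psi' q t k l j"

text \<open>The alternative \<open>j = 1\<close> accounts for the convention that the coordinate 0 of \<open>nb\<close> is \<open>+\<infinity>\<close>.\<close>

definition F :: "nat \<Rightarrow> (nat \<Rightarrow> int) \<Rightarrow> (nat \<Rightarrow> int) \<Rightarrow> nat set" where
  "F k nb l = {j \<in> {1..k}. j = 1 \<or> l j < nb (j - 1)}"

definition xi :: "nat \<Rightarrow> (nat \<Rightarrow> int) \<Rightarrow> (nat \<Rightarrow> int) \<Rightarrow> nat \<Rightarrow> nat" where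
  "xi k nb l i = Max {j \<in> F k nb l. j \<le> i}"

text \<open>
  A family of parameters is a function of \<open>nb\<close>, \<open>l\<close> and an index; only its values at \<open>nb \<prec> l\<close> and at
  admissible indices are ever used (\<open>j + 1 \<in> F\<close> with \<open>1 \<le> j \<le> k - 1\<close> for \<open>r\<close> and \<open>c\<close>, \<open>m \<in> F\<close> for \<open>w\<close>).
\<close>

type_synonym params = "(nat \<Rightarrow> int) \<Rightarrow> (nat \<Rightarrow> int) \<Rightarrow> nat \<Rightarrow> real"

definition W_off ::
  "(nat \<Rightarrow> real) \<Rightarrow> nat \<Rightarrow> params \<Rightarrow> (nat \<Rightarrow> int) \<Rightarrow> (nat \<Rightarrow> int) \<Rightarrow> (nat \<Rightarrow> int) \<Rightarrow> real" where
  "W_off a k w l n nb =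
     (if interlace k nb l then \<Sum>m | m \<in> F k nb l \<and> n = l + e m. a k * w nb l m else 0)"

text \<open>\<open>W a k w l n nb\<close> is the rate \<open>W\<^sub>k(l, n | nb)\<close>.\<close>

definition W ::
  "(nat \<Rightarrow> real) \<Rightarrow> nat \<Rightarrow> params \<Rightarrow> (nat \<Rightarrow> int) \<Rightarrow> (nat \<Rightarrow> int) \<Rightarrow> (nat \<Rightarrow> int) \<Rightarrow> real" where
  "W a k w l n nb =
     (if n = l then - (\<Sum>\<^sub>\<infinity>n'\<in>GT k - {l}. W_off a k w l n' nb) else W_off a k w l n nb)"

text \<open>
  \<open>V k r c l n lb nb\<close> is the probability \<open>V\<^sub>k(l, n | lb, nb)\<close>. The sum over \<open>j\<close> has at most one term.
\<close>

definition V ::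
  "nat \<Rightarrow> params \<Rightarrow> params \<Rightarrow>
   (nat \<Rightarrow> int) \<Rightarrow> (nat \<Rightarrow> int) \<Rightarrow> (nat \<Rightarrow> int) \<Rightarrow> (nat \<Rightarrow> int) \<Rightarrow> real" where
  "V k r c l n lb nb =
     (if lb = nb then (if n = l then 1 else 0)
      else if interlace k nb l then
        \<Sum>j | j \<in> {1..k - 1} \<and> j + 1 \<in> F k nb l \<and> lb = nb - e j.
          (if n = l + e (xi k nb l j) then r nb l j
           else if n = l + e (j + 1) then c nb l j - r nb l j
           else if n = l then 1 - c nb l j
           else 0)
      else
        (if \<exists>j\<in>{1..k - 1}. lb = nb - e j \<and> interlace k (nb - e j) l \<and>
              n = l + e j \<and> interlace k nb (l + e j)
         then 1 else 0))"

definition is_dynamics ::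
  "real \<Rightarrow> real \<Rightarrow> (nat \<Rightarrow> real) \<Rightarrow> nat \<Rightarrow> params \<Rightarrow> params \<Rightarrow> params \<Rightarrow> bool" where
  "is_dynamics q t a k r c w \<longleftrightarrow>
     (\<forall>l\<in>GT k. \<forall>n\<in>GT k. \<forall>nb\<in>GT (k - 1). interlace k nb n \<longrightarrow>
        (\<Sum>\<^sub>\<infinity>lb\<in>GT (k - 1). V k r c l n lb nb * Lambda q t a k l lb * Q q t a (k - 1) lb nb) +
        W a k w l n nb * Lambda q t a k l nb
        = Q q t a k l n * Lambda q t a k n nb)"

text \<open>\<open>jF k nb l m\<close> is \<open>j\<^sub>m\<close>, where \<open>j\<^sub>1 + 1 < j\<^sub>2 + 1 < \<dots>\<close> are the elements of \<open>F k nb l\<close>.\<close>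

definition jF :: "nat \<Rightarrow> (nat \<Rightarrow> int) \<Rightarrow> (nat \<Rightarrow> int) \<Rightarrow> nat \<Rightarrow> nat" where
  "jF k nb l m = sorted_list_of_set (F k nb l) ! (m - 1) - 1"

definition linear_system ::
  "real \<Rightarrow> real \<Rightarrow> nat \<Rightarrow> (nat \<Rightarrow> int) \<Rightarrow> (nat \<Rightarrow> int) \<Rightarrow>
   (nat \<Rightarrow> real) \<Rightarrow> (nat \<Rightarrow> real) \<Rightarrow> (nat \<Rightarrow> real) \<Rightarrow> bool" where
  "linear_system q t k nb l r c w \<longleftrightarrow>
     (let T = T q t k nb l; S = S q t k nb l; j = jF k nb l; \<kappa> = card (F k nb l) in
      if \<kappa> = 1 then w 1 = S 1
      else
        r (j 2) * T (j 2) + w (j 1 + 1) = S (j 1 + 1) \<and>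
        (\<forall>m\<in>{2..\<kappa> - 1}.
           r (j (m + 1)) * T (j (m + 1)) + (c (j m) - r (j m)) * T (j m) + w (j m + 1)
           = S (j m + 1)) \<and>
        (c (j \<kappa>) - r (j \<kappa>)) * T (j \<kappa>) + w (j \<kappa> + 1) = S (j \<kappa> + 1))"

end

theory Submission
  imports Defs
begin

text \<open>
  Put \<open>x\<^sub>j = q\<^bsup>\<lambda>\<^sub>j\<^esup> t\<^bsup>-j\<^esup>\<close> and \<open>y\<^sub>i = q\<^bsup>\<nu>\<^sub>i\<^esup> t\<^bsup>-i\<^esup>\<close>. For generic \<open>q, t\<close> the quantities \<open>S\<^sub>j\<close> and \<open>-T\<^sub>i\<close>
  are, up to a common factor, the residues of
  \<open>\<Prod>\<^sub>j (z - (t/q) x\<^sub>j)/(z - x\<^sub>j) \<Prod>\<^sub>i (z - y\<^sub>i/t)/(z - y\<^sub>i/q) dz/z\<close> at \<open>x\<^sub>j\<close> and \<open>y\<^sub>i/q\<close>, and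
  the poles \<open>0\<close> and \<open>\<infinity>\<close> contribute the constant in
  \<open>\<Sum> S\<^sub>j = 1 + \<Sum> T\<^sub>i\<close>; by continuity this holds for all \<open>q, t \<in> [0, 1)\<close>. Together with a direct
  computation when the interlacing is violated, this is the skew Pieri rule, and induction along the
  branching rule yields \<open>\<Sum>\<^sub>j \<psi>' P\<^bsub>\<lambda> + e\<^sub>j\<^esub> = (a\<^sub>1 + \<dots> + a\<^sub>k) P\<^bsub>\<lambda>\<^esub>\<close>, hence \<open>Q\<^sub>k(\<lambda>, \<lambda>) = -(a\<^sub>1 + \<dots> + a\<^sub>k)\<close>.
  The dynamics equation at \<open>\<nu> = \<lambda> + e\<^sub>m\<close> is, after division by a positive factor, the linear equation
  attached to \<open>m \<in> \<F>\<close>; the one at \<open>\<nu> = \<lambda>\<close> is the sum of these equations, minus \<open>\<Sum> S\<^sub>j = 1 + \<Sum> T\<^sub>i\<close>.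
\<close>

section \<open>Infinite q-products and inequalities between interlacing signatures\<close>

lemma
  fixes x q :: real
  assumes "0 \<le> q" "q < 1" "x < 1" "0 \<le> x"
  shows qpoch_inf_pos: "qpoch_inf x q > 0"
    and qpoch_inf_step: "qpoch_inf x q = (1 - x) * qpoch_inf (q * x) q"
proof -
  have pos: "0 < 1 - x * q ^ i" for i
  proof -
    have "x * q ^ i \<le> x * 1"
      using assms by (intro mult_left_mono power_le_one) auto
    then show ?thesis using assms by simp
  qed
  \<comment> \<open>The deviations from 1 form a geometric series, so the infinite product
    converges; positivity and the splitting of the first factor both rest on this.\<close>
  have "summable (\<lambda>i. norm ((1 - x * q ^ i) - 1))"
    using assms by (simp add: abs_mult summable_mult summable_geometric)
  then have conv: "convergent_prod (\<lambda>i. 1 - x * q ^ i)"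
    by (intro abs_convergent_prod_imp_convergent_prod summable_imp_abs_convergent_prod)
  show "qpoch_inf x q > 0"
    unfolding qpoch_inf_def using conv pos by (intro less_0_prodinf) auto
  show "qpoch_inf x q = (1 - x) * qpoch_inf (q * x) q"
    using prodinf_split_head[OF conv] pos[of 0]
    by (simp add: qpoch_inf_def mult_ac)
qed

lemma antimono_GT:
  assumes "l \<in> GT k" "1 \<le> i" "i \<le> j" "j \<le> k"
  shows "l j \<le> l i"
  using assms(3,4,2)
proof (induction rule: dec_induct)
  case (step n)
  moreover have "l (n + 1) \<le> l n" using step assms(1) by (auto simp: GT_def)
  ultimately show ?case by simp
qed simp

lemma interlace_upper:
  assumes "interlace k b l" "1 \<le> i" "i \<le> j" "j < k"
  shows "b j \<le> l i"
proof -
  have "b j \<le> l j" "l \<in> GT k" using assms by (auto simp: interlace_def)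
  then show ?thesis using antimono_GT[of l k i j] assms by simp
qed

lemma interlace_lower:
  assumes "interlace k b l" "1 \<le> i" "i < j" "j \<le> k"
  shows "l j \<le> b i"
proof -
  have "l (i + 1) \<le> b i" "l \<in> GT k" using assms by (auto simp: interlace_def)
  then show ?thesis using antimono_GT[of l k "i + 1" j] assms by simp
qed

text \<open>Moving one coordinate changes only the factors of \<open>psi\<close> in one row
  \<open>i = j\<close> and one column \<open>l = j'\<close> of the triangle of pairs, so the
  correction collapses to two one-dimensional products. A pair lying on both lines receives both
  corrections.\<close>

lemma prod_pairs_cross:
  fixes r s :: "nat \<Rightarrow> real"
  assumes "1 \<le> j" "j' \<le> M"
  shows "(\<Prod>(i, l)\<in>{(i, l). 1 \<le> i \<and> i \<le> l \<and> l \<le> M}.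
            (if i = j then r l else 1) * (if l = j' then s i else 1))
         = (\<Prod>l\<in>{j..M}. r l) * (\<Prod>i\<in>{1..j'}. s i)"
proof -
  let ?D = "{(i, l). 1 \<le> i \<and> i \<le> l \<and> l \<le> M}"
  have fin: "finite ?D"
    by (rule finite_subset[of _ "{..M} \<times> {..M}"]) auto
  have "(\<Prod>(i, l)\<in>?D. if i = j then r l else 1) = (\<Prod>(i, l)\<in>Pair j ` {j..M}. r l)"
    using assms fin by (intro prod.mono_neutral_cong_right) auto
  also have "\<dots> = (\<Prod>l\<in>{j..M}. r l)"
    by (subst prod.reindex) (auto simp: inj_on_def)
  finally have 1: "(\<Prod>(i, l)\<in>?D. if i = j then r l else 1) = (\<Prod>l\<in>{j..M}. r l)" .
  have "(\<Prod>(i, l)\<in>?D. if l = j' then s i else 1) = (\<Prod>(i, l)\<in>(\<lambda>i. (i, j')) ` {1..j'}. s i)"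
    using assms fin by (intro prod.mono_neutral_cong_right) auto
  also have "\<dots> = (\<Prod>i\<in>{1..j'}. s i)"
    by (subst prod.reindex) (auto simp: inj_on_def)
  finally have 2: "(\<Prod>(i, l)\<in>?D. if l = j' then s i else 1) = (\<Prod>i\<in>{1..j'}. s i)" .
  show ?thesis
    unfolding 1[symmetric] 2[symmetric] prod.distrib[symmetric] by (rule prod.cong) auto
qed

section \<open>Change of \<open>psi\<close> when one coordinate moves\<close>

context
  fixes q t :: real
  assumes q: "0 \<le> q" "q < 1" and t: "0 \<le> t" "t < 1"
begin

lemma f_pos:
  assumes "0 \<le> u" "u \<le> 1"
  shows "f q t u > 0"
proof -
  have "t * u \<le> t * 1" "q * u \<le> q * 1"
    using q t assms by (intro mult_left_mono; simp)+
  then show ?thesis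
    unfolding f_def using q t assms by (intro divide_pos_pos qpoch_inf_pos) auto
qed

text \<open>Replacing \<open>u\<close> by \<open>q * u\<close> removes the first factor from both
  q-products, so the infinite products cancel from the ratio. This is how rational functions arise
  from \<open>psi\<close>.\<close>

lemma f_mult_q:
  assumes "0 \<le> u" "u \<le> 1"
  shows "f q t (q * u) = f q t u * ((1 - q * u) / (1 - t * u))"
proof -
  have le: "t * u \<le> t * 1" "q * u \<le> q * 1"
    using q t assms by (intro mult_left_mono; simp)+
  have "q * (q * u) \<le> 1 * (q * u)" "q * (t * u) \<le> 1 * (t * u)"
    using q t assms by (intro mult_right_mono; simp)+
  then have nz: "qpoch_inf (q * (q * u)) q \<noteq> 0" "qpoch_inf (q * (t * u)) q \<noteq> 0"
    using q t assms le qpoch_inf_pos[of q "q * (q * u)"] qpoch_inf_pos[of q "q * (t * u)"] by auto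
  have "qpoch_inf (t * u) q = (1 - t * u) * qpoch_inf (q * (t * u)) q"
    "qpoch_inf (q * u) q = (1 - q * u) * qpoch_inf (q * (q * u)) q"
    using q t assms le by (intro qpoch_inf_step; simp)+
  then show ?thesis
    using le q t nz by (simp add: f_def mult.left_commute)
qed

lemma monomial_bounds:
  assumes "0 \<le> x"
  shows "0 \<le> q powi x * t ^ b" "q powi x * t ^ b \<le> 1"
  using assms q t by (auto intro!: mult_le_one power_int_le_one power_le_one)

text \<open>One factor \<open>q\<close> or \<open>t\<close> is split off, and the rest is at most 1.
  This keeps the denominators nonzero, also for \<open>q = 0\<close> or
  \<open>t = 0\<close>.\<close>

lemma monomial_less_1:
  assumes "0 \<le> x" "0 < x \<or> 0 < b"
  shows "q powi x * t ^ b < 1"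
  using assms(2)
proof
  assume "0 < x"
  then have "q powi x = q * q powi (x - 1)"
    by (simp add: power_int_nonneg_exp flip: power_Suc) (simp add: Suc_nat_eq_nat_zadd1)
  then have "q powi x * t ^ b = q * (q powi (x - 1) * t ^ b)" by simp
  also have "\<dots> \<le> q * 1"
    using \<open>0 < x\<close> q by (intro mult_left_mono monomial_bounds) auto
  finally show ?thesis using q by simp
next
  assume "0 < b"
  then have "q powi x * t ^ b = t * (q powi x * t ^ (b - 1))"
    by (cases b) auto
  also have "\<dots> \<le> t * 1"
    using assms t by (intro mult_left_mono monomial_bounds) auto
  finally show ?thesis using t by simp
qed

lemma f_shift:
  assumes "0 \<le> x"
  shows "f q t (q powi (x + 1) * t ^ b) =
    f q t (q powi x * t ^ b) * ((1 - q powi (x + 1) * t ^ b) / (1 - q powi x * t ^ (b + 1)))"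
proof -
  have "q powi (x + 1) = q * q powi x"
    using assms by (simp add: power_int_nonneg_exp nat_add_distrib)
  then show ?thesis
    using f_mult_q[of "q powi x * t ^ b"] monomial_bounds[OF assms, of b] by (simp add: mult_ac)
qed

text \<open>This is \<open>f_shift\<close> at \<open>x - 1\<close>, solved for the other value;
  \<open>1 \<le> x\<close> keeps the lowered exponent nonnegative.\<close>

lemma f_shift_down:
  assumes "1 \<le> x"
  shows "f q t (q powi (x - 1) * t ^ b) =
    f q t (q powi x * t ^ b) * ((1 - q powi (x - 1) * t ^ (b + 1)) / (1 - q powi x * t ^ b))"
proof -
  have "1 - q powi (x - 1) * t ^ (b + 1) \<noteq> 0" "1 - q powi x * t ^ b \<noteq> 0"
    using monomial_less_1[of "x - 1" "b + 1"] monomial_less_1[of x b] assms by auto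
  then show ?thesis using f_shift[of "x - 1" b] assms by simp
qed

lemma psi_pos:
  assumes "interlace k b l"
  shows "psi q t k l b > 0"
proof -
  have GT: "b \<in> GT (k - 1)" "l \<in> GT k" using assms by (auto simp: interlace_def)
  have "0 < f q t (q powi (b i - b j) * t ^ (j - i)) \<and> 0 < f q t (q powi (l i - l (j + 1)) * t ^ (j - i)) \<and>
      0 < f q t (q powi (l i - b j) * t ^ (j - i)) \<and> 0 < f q t (q powi (b i - l (j + 1)) * t ^ (j - i))"
    if "1 \<le> i" "i \<le> j" "j \<le> k - 1" for i j
    using that antimono_GT[OF GT(1), of i j] antimono_GT[OF GT(2), of i "j + 1"]
      interlace_upper[OF assms, of i j] interlace_lower[OF assms, of i "j + 1"]
    by (intro conjI f_pos monomial_bounds) auto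
  then show ?thesis
    using assms by (auto simp: psi_def intro!: prod_pos mult_pos_pos divide_pos_pos)
qed

text \<open>The coordinate \<open>l j\<close> enters with positive sign in the row
  \<open>i = j\<close>, where arguments of \<open>f\<close> gain a factor \<open>q\<close>, and with
  negative sign in the column \<open>n = j - 1\<close>, where they lose one. By
  \<open>f_shift\<close> and \<open>f_shift_down\<close> each change costs a rational
  factor.\<close>

lemma psi_shift_upper:
  assumes il: "interlace k b l" and il': "interlace k b (l + e j)" and j: "j \<in> {1..k}"
  shows "psi q t k (l + e j) b = psi q t k l b *
    ((\<Prod>n\<in>{j..<k}. ((1 - q powi (l j - l (n + 1) + 1) * t ^ (n - j)) / (1 - q powi (l j - l (n + 1)) * t ^ (n - j + 1))) *
        ((1 - q powi (l j - b n) * t ^ (n - j + 1)) / (1 - q powi (l j - b n + 1) * t ^ (n - j)))) *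
     (\<Prod>i\<in>{1..<j}. ((1 - q powi (l i - l j - 1) * t ^ (j - i)) / (1 - q powi (l i - l j) * t ^ (j - i - 1))) *
        ((1 - q powi (b i - l j) * t ^ (j - i - 1)) / (1 - q powi (b i - l j - 1) * t ^ (j - i)))))"
    (is "_ = _ * ((\<Prod>n\<in>_. ?r n) * (\<Prod>i\<in>_. ?s i))")
proof -
  have GT: "b \<in> GT (k - 1)" "l \<in> GT k" using il by (auto simp: interlace_def)
  let ?D = "{(i, n). 1 \<le> i \<and> i \<le> n \<and> n \<le> k - 1}"
  \<comment> \<open>Since \<open>l\<close> can still be raised at \<open>j\<close>, these gaps are
    at least 1, and the exponents lowered in the column stay nonnegative.\<close>
  have up: "l i - l j \<ge> 1" "b i - l j \<ge> 1" if "i \<in> {1..<j}" for i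
    using that j interlace_lower[OF il', of i j] interlace_upper[OF il, of i i] by (auto simp: e_def)
  have sets: "{j..<k} = {j..k - 1}" "{1..<j} = {1..j - 1}" using j by auto
  have "(\<Prod>n\<in>{j..<k}. ?r n) * (\<Prod>i\<in>{1..<j}. ?s i) =
    (\<Prod>(i, n)\<in>?D. (if i = j then ?r n else 1) * (if n = j - 1 then ?s i else 1))"
    unfolding sets by (rule prod_pairs_cross[symmetric]) (use j in auto)
  then have eq: "psi q t k l b * ((\<Prod>n\<in>{j..<k}. ?r n) * (\<Prod>i\<in>{1..<j}. ?s i)) =
    psi q t k l b * (\<Prod>(i, n)\<in>?D. (if i = j then ?r n else 1) * (if n = j - 1 then ?s i else 1))"
    by (simp only:)
  have factor: "(f q t (q powi (b i - b n) * t ^ (n - i)) *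
          f q t (q powi ((l + e j) i - (l + e j) (n + 1)) * t ^ (n - i))) /
         (f q t (q powi ((l + e j) i - b n) * t ^ (n - i)) *
          f q t (q powi (b i - (l + e j) (n + 1)) * t ^ (n - i))) =
        (f q t (q powi (b i - b n) * t ^ (n - i)) *
          f q t (q powi (l i - l (n + 1)) * t ^ (n - i))) /
         (f q t (q powi (l i - b n) * t ^ (n - i)) *
          f q t (q powi (b i - l (n + 1)) * t ^ (n - i))) *
         ((if i = j then ?r n else 1) * (if n = j - 1 then ?s i else 1))"
    if rng: "1 \<le> i" "i \<le> n" "n \<le> k - 1" for i n
  proof -
    consider "i = j" "n \<noteq> j - 1" | "i \<noteq> j" "n = j - 1" | "i \<noteq> j" "n \<noteq> j - 1"
      using rng j by fastforce
    then show ?thesis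
    proof cases
      case 1
      have "l j - l (n + 1) \<ge> 0" "l j - b n \<ge> 0"
        using rng 1 j antimono_GT[OF GT(2), of j "n + 1"] interlace_upper[OF il, of j n] by auto
      from f_shift[OF this(1), of "n - j"] f_shift[OF this(2), of "n - j"] 1 rng
      show ?thesis
        by (simp add: e_def algebra_simps)
    next
      case 2
      then have n: "j = Suc n" using j by auto
      have "l i - l j \<ge> 1" "b i - l j \<ge> 1" using up[of i] n rng by auto
      from f_shift_down[OF this(1), of "n - i"] f_shift_down[OF this(2), of "n - i"] n rng
      show ?thesis
        by (simp add: e_def Suc_diff_le diff_diff_eq[symmetric] mult_ac)
    next
      case 3
      then have "Suc n \<noteq> j" using rng by auto
      with 3 show ?thesis by (simp add: e_def)
    qed
  qed
  show ?thesis
    unfolding eq unfolding psi_def if_P[OF il] if_P[OF il'] prod.distrib[symmetric]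
    by (rule prod.cong[OF refl]) (use factor in auto)
qed

text \<open>The coordinate \<open>b j\<close> occurs in the row \<open>i = j\<close> and in the
  column \<open>n = j\<close>. They meet at the diagonal pair, where the difference
  \<open>b j - b j\<close> does not change; therefore the two products of differences within
  \<open>b\<close> omit the index \<open>j\<close>.\<close>

lemma psi_shift_lower:
  assumes il: "interlace k b l" and il': "interlace k (b + e j) l" and j: "j \<in> {1..<k}"
  shows "psi q t k l (b + e j) = psi q t k l b *
    ((\<Prod>n\<in>{j<..<k}. (1 - q powi (b j - b n + 1) * t ^ (n - j)) / (1 - q powi (b j - b n) * t ^ (n - j + 1))) *
     (\<Prod>n\<in>{j..<k}. (1 - q powi (b j - l (n + 1)) * t ^ (n - j + 1)) / (1 - q powi (b j - l (n + 1) + 1) * t ^ (n - j))) *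
     (\<Prod>i\<in>{1..<j}. (1 - q powi (b i - b j - 1) * t ^ (j - i + 1)) / (1 - q powi (b i - b j) * t ^ (j - i))) *
     (\<Prod>i\<in>{1..j}. (1 - q powi (l i - b j) * t ^ (j - i)) / (1 - q powi (l i - b j - 1) * t ^ (j - i + 1))))"
    (is "_ = _ * ((\<Prod>n\<in>_. ?r1 n) * (\<Prod>n\<in>_. ?r2 n) * (\<Prod>i\<in>_. ?s1 i) * (\<Prod>i\<in>_. ?s2 i))")
proof -
  have GT: "b \<in> GT (k - 1)" "b + e j \<in> GT (k - 1)" "l \<in> GT k"
    using il il' by (auto simp: interlace_def)
  let ?D = "{(i, n). 1 \<le> i \<and> i \<le> n \<and> n \<le> k - 1}"
  let ?r = "\<lambda>n. (if n = j then 1 else ?r1 n) * ?r2 n"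
  let ?s = "\<lambda>i. (if i = j then 1 else ?s1 i) * ?s2 i"
  have sets: "{j..<k} = {j..k - 1}" "{j<..<k} = {j<..k - 1}" using j by auto
  have r1: "(\<Prod>n\<in>{j<..k - 1}. ?r1 n) = (\<Prod>n\<in>{j..k - 1}. if n = j then 1 else ?r1 n)"
    by (intro prod.mono_neutral_cong_left) auto
  have s1: "(\<Prod>i\<in>{1..<j}. ?s1 i) = (\<Prod>i\<in>{1..j}. if i = j then 1 else ?s1 i)"
    by (intro prod.mono_neutral_cong_left) auto
  have "(\<Prod>n\<in>{j<..<k}. ?r1 n) * (\<Prod>n\<in>{j..<k}. ?r2 n) * (\<Prod>i\<in>{1..<j}. ?s1 i) * (\<Prod>i\<in>{1..j}. ?s2 i) =
    (\<Prod>n\<in>{j..k - 1}. ?r n) * (\<Prod>i\<in>{1..j}. ?s i)"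
    unfolding sets unfolding r1 s1 prod.distrib by (rule mult.assoc)
  also have "\<dots> = (\<Prod>(i, n)\<in>?D. (if i = j then ?r n else 1) * (if n = j then ?s i else 1))"
    by (rule prod_pairs_cross[symmetric]) (use j in auto)
  finally have eq: "psi q t k l b * ((\<Prod>n\<in>{j<..<k}. ?r1 n) * (\<Prod>n\<in>{j..<k}. ?r2 n) *
      (\<Prod>i\<in>{1..<j}. ?s1 i) * (\<Prod>i\<in>{1..j}. ?s2 i)) =
    psi q t k l b * (\<Prod>(i, n)\<in>?D. (if i = j then ?r n else 1) * (if n = j then ?s i else 1))"
    by (simp only:)
  have factor: "(f q t (q powi ((b + e j) i - (b + e j) n) * t ^ (n - i)) *
          f q t (q powi (l i - l (n + 1)) * t ^ (n - i))) /
         (f q t (q powi (l i - (b + e j) n) * t ^ (n - i)) *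
          f q t (q powi ((b + e j) i - l (n + 1)) * t ^ (n - i))) =
        (f q t (q powi (b i - b n) * t ^ (n - i)) *
          f q t (q powi (l i - l (n + 1)) * t ^ (n - i))) /
         (f q t (q powi (l i - b n) * t ^ (n - i)) *
          f q t (q powi (b i - l (n + 1)) * t ^ (n - i))) *
         ((if i = j then ?r n else 1) * (if n = j then ?s i else 1))"
    if rng: "1 \<le> i" "i \<le> n" "n \<le> k - 1" for i n
  proof -
    consider "i = j" "n = j" | "i = j" "n \<noteq> j" | "i \<noteq> j" "n = j" | "i \<noteq> j" "n \<noteq> j" by blast
    then show ?thesis
    proof cases
      case 1
      have "l j - b j \<ge> 1" "b j - l (j + 1) \<ge> 0"
        using interlace_upper[OF il', of j j] interlace_lower[OF il, of j "j + 1"] j by (auto simp: e_def)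
      from f_shift_down[OF this(1), of 0] f_shift[OF this(2), of 0] 1 show ?thesis
        by (simp add: e_def algebra_simps)
    next
      case 2
      have "b j - b n \<ge> 0" "b j - l (n + 1) \<ge> 0"
        using antimono_GT[OF GT(1), of j n] interlace_lower[OF il, of j "n + 1"] j rng 2 by auto
      from f_shift[OF this(1), of "n - j"] f_shift[OF this(2), of "n - j"] 2 show ?thesis
        by (simp add: e_def algebra_simps)
    next
      case 3
      have "b i - b j \<ge> 1" "l i - b j \<ge> 1"
        using antimono_GT[OF GT(2), of i j] interlace_upper[OF il', of i j] j rng 3 by (auto simp: e_def)
      from f_shift_down[OF this(1), of "j - i"] f_shift_down[OF this(2), of "j - i"] 3 show ?thesis
        by (simp add: e_def diff_diff_eq[symmetric] mult_ac)
    next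
      case 4
      then show ?thesis using rng by (simp add: e_def)
    qed
  qed
  show ?thesis
    unfolding eq unfolding psi_def if_P[OF il] if_P[OF il'] prod.distrib[symmetric]
    by (rule prod.cong[OF refl]) (use factor in auto)
qed

end

section \<open>Rational product formulas for \<open>S\<close> and \<open>T\<close>, and forced
  moves\<close>

text \<open>What remains of \<open>S\<close> once the infinite products have cancelled. There is no
  interlacing test: for a blocked move a numerator factor vanishes instead, so sums can be extended
  to all indices.\<close>

definition S_prod :: "real \<Rightarrow> real \<Rightarrow> nat \<Rightarrow> (nat \<Rightarrow> int) \<Rightarrow> (nat \<Rightarrow> int) \<Rightarrow> nat \<Rightarrow> real" where
  "S_prod q t k b l j =
     (\<Prod>i\<in>{1..<j}.
        ((1 - q powi (l i - l j - 1) * t ^ (j - i + 1)) / (1 - q powi (l i - l j) * t ^ (j - i))) *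
        ((1 - q powi (b i - l j) * t ^ (j - i - 1)) / (1 - q powi (b i - l j - 1) * t ^ (j - i)))) *
     (\<Prod>n\<in>{j..<k}.
        ((1 - q powi (l j - l (n + 1) + 1) * t ^ (n - j)) / (1 - q powi (l j - l (n + 1)) * t ^ (n - j + 1))) *
        ((1 - q powi (l j - b n) * t ^ (n - j + 1)) / (1 - q powi (l j - b n + 1) * t ^ (n - j))))"

definition T_prod :: "real \<Rightarrow> real \<Rightarrow> nat \<Rightarrow> (nat \<Rightarrow> int) \<Rightarrow> (nat \<Rightarrow> int) \<Rightarrow> nat \<Rightarrow> real" where
  "T_prod q t k b l j =
     (\<Prod>n\<in>{j<..<k}. (1 - q powi (b j - b n - 1) * t ^ (n - j + 1)) / (1 - q powi (b j - b n) * t ^ (n - j))) *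
     (\<Prod>n\<in>{j..<k}. (1 - q powi (b j - l (n + 1)) * t ^ (n - j)) / (1 - q powi (b j - l (n + 1) - 1) * t ^ (n - j + 1))) *
     (\<Prod>i\<in>{1..<j}. (1 - q powi (b i - b j + 1) * t ^ (j - i - 1)) / (1 - q powi (b i - b j) * t ^ (j - i))) *
     (\<Prod>i\<in>{1..j}. (1 - q powi (l i - b j) * t ^ (j - i + 1)) / (1 - q powi (l i - b j + 1) * t ^ (j - i)))"

context
  fixes q t :: real
  assumes q: "0 \<le> q" "q < 1" and t: "0 \<le> t" "t < 1"
begin

lemma monomial_neq_1:
  assumes "0 \<le> x" "0 < x \<or> 0 < b"
  shows "1 - q powi x * t ^ b \<noteq> 0"
  using monomial_less_1[OF q t assms] by simp

text \<open>For each \<open>i < j\<close> the factor of \<open>psi'\<close> trades the quotient of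
  differences within \<open>l\<close> from \<open>psi_shift_upper\<close> for the one in
  \<open>S_prod\<close>. The gap of at least 1 between \<open>l i\<close> and \<open>l j\<close>
  makes the cancelled factors nonzero.\<close>

lemma S_eq_S_prod:
  assumes il: "interlace k b l" and il': "interlace k b (l + e j)" and j: "j \<in> {1..k}"
  shows "S q t k b l j = S_prod q t k b l j"
proof -
  have GT: "l \<in> GT k" "l + e j \<in> GT k" using il il' by (auto simp: interlace_def)
  have up: "l i - l j \<ge> 1" if "i \<in> {1..<j}" for i
    using that j antimono_GT[OF GT(2), of i j] by (auto simp: e_def)
  let ?C = "\<lambda>i. ((1 - q powi (l i - l j - 1) * t ^ (j - i)) / (1 - q powi (l i - l j) * t ^ (j - i - 1))) *
      ((1 - q powi (b i - l j) * t ^ (j - i - 1)) / (1 - q powi (b i - l j - 1) * t ^ (j - i)))"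
  let ?G = "\<lambda>i. (((1 - q powi (l i - l j) * t ^ (j - i - 1)) * (1 - q powi (l i - l j - 1) * t ^ (j - i + 1))) /
       ((1 - q powi (l i - l j) * t ^ (j - i)) * (1 - q powi (l i - l j - 1) * t ^ (j - i))))"
  let ?R = "\<lambda>i. ((1 - q powi (l i - l j - 1) * t ^ (j - i + 1)) / (1 - q powi (l i - l j) * t ^ (j - i))) *
      ((1 - q powi (b i - l j) * t ^ (j - i - 1)) / (1 - q powi (b i - l j - 1) * t ^ (j - i)))"
  have cancel: "?R i = ?C i * ?G i" if "i \<in> {1..<j}" for i
  proof -
    have "1 - q powi (l i - l j - 1) * t ^ (j - i) \<noteq> 0" "1 - q powi (l i - l j) * t ^ (j - i - 1) \<noteq> 0"
      using up[OF that] that by (intro monomial_neq_1; simp)+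
    then show ?thesis by (simp add: mult_ac)
  qed
  have head: "(\<Prod>i\<in>{1..<j}. ?R i) = (\<Prod>i\<in>{1..<j}. ?C i) * (\<Prod>i\<in>{1..<j}. ?G i)"
    unfolding prod.distrib[of ?C ?G, symmetric] by (intro prod.cong refl cancel)
  have psi': "psi' q t k l j = (\<Prod>i\<in>{1..<j}.
      (((1 - q powi (l i - l j) * t ^ (j - i - 1)) * (1 - q powi (l i - l j - 1) * t ^ (j - i + 1))) /
       ((1 - q powi (l i - l j) * t ^ (j - i)) * (1 - q powi (l i - l j - 1) * t ^ (j - i)))))"
    using GT by (simp add: psi'_def)
  have nz: "psi q t k l b \<noteq> 0" using psi_pos[OF q t il] by simp
  have S: "S q t k b l j = X * Y * psi' q t k l j"
    if "psi q t k (l + e j) b = psi q t k l b * (X * Y)" for X Y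
    unfolding S_def that using nz by simp
  show ?thesis
    unfolding S[OF psi_shift_upper[OF q t assms]] psi' S_prod_def head
    by (simp only: mult_ac)
qed

text \<open>The formula \<open>psi_shift_lower\<close> starts from the lower point, here
  \<open>d = b - e j\<close>, and is used inverted. The factors of \<open>psi'\<close> simplify the
  product over \<open>i < j\<close>; the rest is the substitution
  \<open>b j = d j + 1\<close>.\<close>

lemma T_eq_T_prod:
  assumes il: "interlace k b l" and il': "interlace k (b - e j) l" and j: "j \<in> {1..<k}"
  shows "T q t k b l j = T_prod q t k b l j"
proof -
  define d where "d = b - e j"
  have b: "b = d + e j" by (simp add: d_def)
  have il_d: "interlace k d l" "interlace k (d + e j) l" using il il' by (simp_all add: d_def)
  have GT: "d \<in> GT (k - 1)" "d + e j \<in> GT (k - 1)" using il_d by (auto simp: interlace_def)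
  have "j \<le> k - 1" using j by (cases k) auto
  then have up: "d i - d j \<ge> 1" if "i \<in> {1..<j}" for i
    using that j antimono_GT[OF GT(2), of i j] by (auto simp: e_def)
  have inv: "psi q t k l d / psi q t k l (d + e j) =
    (\<Prod>n\<in>{j<..<k}. (1 - q powi (d j - d n) * t ^ (n - j + 1)) / (1 - q powi (d j - d n + 1) * t ^ (n - j))) *
     (\<Prod>n\<in>{j..<k}. (1 - q powi (d j - l (n + 1) + 1) * t ^ (n - j)) / (1 - q powi (d j - l (n + 1)) * t ^ (n - j + 1))) *
     (\<Prod>i\<in>{1..<j}. (1 - q powi (d i - d j) * t ^ (j - i)) / (1 - q powi (d i - d j - 1) * t ^ (j - i + 1))) *
     (\<Prod>i\<in>{1..j}. (1 - q powi (l i - d j - 1) * t ^ (j - i + 1)) / (1 - q powi (l i - d j) * t ^ (j - i)))"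
    unfolding psi_shift_lower[OF q t il_d j] using psi_pos[OF q t il_d(1)]
    by (simp add: divide_inverse prod_inversef[symmetric] mult_ac)
  have cancel: "(1 - q powi (d i - d j) * t ^ (j - i)) / (1 - q powi (d i - d j - 1) * t ^ (j - i + 1)) *
      (((1 - q powi (d i - d j) * t ^ (j - i - 1)) * (1 - q powi (d i - d j - 1) * t ^ (j - i + 1))) /
       ((1 - q powi (d i - d j) * t ^ (j - i)) * (1 - q powi (d i - d j - 1) * t ^ (j - i)))) =
     (1 - q powi (d i - d j) * t ^ (j - i - 1)) / (1 - q powi (d i - d j - 1) * t ^ (j - i))"
    if "i \<in> {1..<j}" for i
  proof -
    have "1 - q powi (d i - d j - 1) * t ^ (j - i + 1) \<noteq> 0" "1 - q powi (d i - d j) * t ^ (j - i) \<noteq> 0"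
      using up[OF that] that by (intro monomial_neq_1; simp)+
    then show ?thesis by simp
  qed
  have p3: "(\<Prod>i\<in>{1..<j}. (1 - q powi (d i - d j) * t ^ (j - i)) / (1 - q powi (d i - d j - 1) * t ^ (j - i + 1))) *
      psi' q t (k - 1) d j =
      (\<Prod>i\<in>{1..<j}. (1 - q powi (b i - b j + 1) * t ^ (j - i - 1)) / (1 - q powi (b i - b j) * t ^ (j - i)))"
    unfolding psi'_def using GT
    by (simp only: simp_thms if_True prod.distrib[symmetric])
       (rule prod.cong[OF refl], subst cancel, auto simp: b e_def diff_diff_eq[symmetric])
  have p1: "(\<Prod>n\<in>{j<..<k}. (1 - q powi (d j - d n) * t ^ (n - j + 1)) / (1 - q powi (d j - d n + 1) * t ^ (n - j))) =
      (\<Prod>n\<in>{j<..<k}. (1 - q powi (b j - b n - 1) * t ^ (n - j + 1)) / (1 - q powi (b j - b n) * t ^ (n - j)))"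
    by (rule prod.cong) (auto simp: b e_def algebra_simps)
  have p2: "(\<Prod>n\<in>{j..<k}. (1 - q powi (d j - l (n + 1) + 1) * t ^ (n - j)) / (1 - q powi (d j - l (n + 1)) * t ^ (n - j + 1))) =
      (\<Prod>n\<in>{j..<k}. (1 - q powi (b j - l (n + 1)) * t ^ (n - j)) / (1 - q powi (b j - l (n + 1) - 1) * t ^ (n - j + 1)))"
    by (rule prod.cong) (auto simp: b e_def algebra_simps)
  have p4: "(\<Prod>i\<in>{1..j}. (1 - q powi (l i - d j - 1) * t ^ (j - i + 1)) / (1 - q powi (l i - d j) * t ^ (j - i))) =
      (\<Prod>i\<in>{1..j}. (1 - q powi (l i - b j) * t ^ (j - i + 1)) / (1 - q powi (l i - b j + 1) * t ^ (j - i)))"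
    by (rule prod.cong) (auto simp: b e_def algebra_simps)
  have "T q t k b l j = psi q t k l d / psi q t k l (d + e j) * psi' q t (k - 1) d j"
    by (simp add: T_def d_def)
  also have "\<dots> = T_prod q t k b l j"
    unfolding inv T_prod_def p1[symmetric] p2[symmetric] p3[symmetric] p4[symmetric]
    by (simp only: mult_ac)
  finally show ?thesis .
qed

text \<open>Here \<open>b = \<nu> - e\<^sub>j\<close> in the case \<open>V = 1\<close>, where the move of \<open>b\<close> forces the move of \<open>l\<close>.\<close>

lemma psi_forced_move:
  assumes il: "interlace k b l" and il': "interlace k (b + e j) (l + e j)"
    and j: "j \<in> {1..<k}" and eq: "b j = l j"
  shows "psi q t k (l + e j) (b + e j) * psi' q t k l j = psi q t k l b * psi' q t (k - 1) b j"
proof -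
  have GT: "b \<in> GT (k - 1)" "b + e j \<in> GT (k - 1)" "l \<in> GT k" "l + e j \<in> GT k"
    using il il' by (auto simp: interlace_def)
  \<comment> \<open>The joint move is made in two steps, first \<open>l\<close> and then
    \<open>b\<close>; the intermediate pair still interlaces, so both shift formulas apply.\<close>
  have il2: "interlace k b (l + e j)"
    unfolding interlace_def
  proof (intro conjI ballI)
    fix i assume i: "i \<in> {1..k - 1}"
    then have "l i \<ge> b i" "(l + e j) (i + 1) \<le> (b + e j) i" "l (i + 1) \<le> b i"
      using il il' by (auto simp: interlace_def)
    then show "(l + e j) (i + 1) \<le> b i" "b i \<le> (l + e j) i"
      by (auto simp: e_def split: if_splits)
  qed (use GT in auto)
  have "j \<le> k - 1" using j by (cases k) auto
  then have up: "l i - l j \<ge> 1" "b i - l j \<ge> 1" if "i \<in> {1..<j}" for i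
    using that j antimono_GT[OF GT(4), of i j] antimono_GT[OF GT(2), of i j] eq by (auto simp: e_def)
  have down: "l j - l (n + 1) \<ge> 0" "n < k - 1 \<Longrightarrow> l j - b (n + 1) \<ge> 0" if "n \<in> {j..<k}" for n
    using that j antimono_GT[OF GT(3), of j "n + 1"] interlace_upper[OF il, of j "n + 1"] by auto
  have jk: "{j..<k} = insert j {j<..<k}" and j1: "{1..j} = insert j {1..<j}" using j by auto
  define A where "A = (\<lambda>n. (1 - q powi (l j - l (n + 1) + 1) * t ^ (n - j)) / (1 - q powi (l j - l (n + 1)) * t ^ (n - j + 1)))"
  define B where "B = (\<lambda>n. (1 - q powi (l j - b n) * t ^ (n - j + 1)) / (1 - q powi (l j - b n + 1) * t ^ (n - j)))"
  define C where "C = (\<lambda>i. (1 - q powi (l i - l j - 1) * t ^ (j - i)) / (1 - q powi (l i - l j) * t ^ (j - i - 1)) *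
        ((1 - q powi (b i - l j) * t ^ (j - i - 1)) / (1 - q powi (b i - l j - 1) * t ^ (j - i))))"
  define D where "D = (\<lambda>i. (1 - q powi (b i - l j - 1) * t ^ (j - i + 1)) / (1 - q powi (b i - l j) * t ^ (j - i)))"
  define E where "E = (\<lambda>i. (1 - q powi (l i - l j) * t ^ (j - i)) / (1 - q powi (l i - l j - 1) * t ^ (j - i + 1)))"
  define G where "G = (\<lambda>(m :: nat \<Rightarrow> int) i. (1 - q powi (m i - m j) * t ^ (j - i - 1)) * (1 - q powi (m i - m j - 1) * t ^ (j - i + 1)) /
       ((1 - q powi (m i - m j) * t ^ (j - i)) * (1 - q powi (m i - m j - 1) * t ^ (j - i))))"
  have A: "A n \<noteq> 0" if "n \<in> {j..<k}" for n
    unfolding A_def divide_eq_0_iff de_Morgan_disj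
    using down(1)[OF that] by (intro conjI monomial_neq_1) auto
  have B: "B n \<noteq> 0" if "n \<in> {j..<k}" for n
    unfolding B_def divide_eq_0_iff de_Morgan_disj
    using interlace_upper[OF il, of j n] that j by (intro conjI monomial_neq_1) auto
  have upper: "psi q t k (l + e j) b = psi q t k l b * ((\<Prod>n\<in>{j..<k}. A n * B n) * (\<Prod>i\<in>{1..<j}. C i))"
    using psi_shift_upper[OF q t il il2] j by (simp add: A_def B_def C_def)
  have lower: "psi q t k (l + e j) (b + e j) = psi q t k (l + e j) b *
     ((\<Prod>n\<in>{j<..<k}. 1 / B n) * (\<Prod>n\<in>{j..<k}. 1 / A n) * (\<Prod>i\<in>{1..<j}. D i) *
      (1 / B j * (\<Prod>i\<in>{1..<j}. E i)))"
  proof -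
    have "(\<Prod>i\<in>{1..<j}. (1 - q powi ((l + e j) i - b j) * t ^ (j - i)) / (1 - q powi ((l + e j) i - b j - 1) * t ^ (j - i + 1)))
        = (\<Prod>i\<in>{1..<j}. E i)"
      by (rule prod.cong) (auto simp: E_def e_def eq)
    then have "(\<Prod>i\<in>{1..j}. (1 - q powi ((l + e j) i - b j) * t ^ (j - i)) / (1 - q powi ((l + e j) i - b j - 1) * t ^ (j - i + 1)))
        = 1 / B j * (\<Prod>i\<in>{1..<j}. E i)"
      unfolding j1 by (subst prod.insert) (auto simp: B_def e_def eq)
    moreover have "(\<Prod>n\<in>{j..<k}. (1 - q powi (b j - (l + e j) (n + 1)) * t ^ (n - j + 1)) / (1 - q powi (b j - (l + e j) (n + 1) + 1) * t ^ (n - j)))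
        = (\<Prod>n\<in>{j..<k}. 1 / A n)"
      by (rule prod.cong) (auto simp: A_def e_def eq)
    ultimately show ?thesis
      using psi_shift_lower[OF q t il2 il' j] by (simp add: B_def D_def eq)
  qed
  \<comment> \<open>The factors with index at least \<open>j\<close> produced by the two steps are
    inverse to each other. The missing diagonal factor \<open>1 / B j\<close> comes from the pair
    \<open>l j\<close>, \<open>b j\<close> in the second step, where
    \<open>b j = l j\<close>.\<close>
  have tail: "(\<Prod>n\<in>{j..<k}. A n * B n) * ((\<Prod>n\<in>{j<..<k}. 1 / B n) * (\<Prod>n\<in>{j..<k}. 1 / A n) * (1 / B j)) = 1"
  proof -
    have B_split: "(\<Prod>n\<in>{j..<k}. 1 / B n) = (\<Prod>n\<in>{j<..<k}. 1 / B n) * (1 / B j)"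
      unfolding jk by (subst prod.insert) auto
    have "(\<Prod>n\<in>{j..<k}. A n * B n) * ((\<Prod>n\<in>{j<..<k}. 1 / B n) * (\<Prod>n\<in>{j..<k}. 1 / A n) * (1 / B j)) =
      (\<Prod>n\<in>{j..<k}. A n * B n) * ((\<Prod>n\<in>{j..<k}. 1 / A n) * (\<Prod>n\<in>{j..<k}. 1 / B n))"
      unfolding B_split by (simp only: mult_ac)
    also have "\<dots> = (\<Prod>n\<in>{j..<k}. A n * B n * (1 / A n * (1 / B n)))"
      by (simp only: prod.distrib)
    also have "\<dots> = 1"
      using A B by (intro prod.neutral) auto
    finally show ?thesis .
  qed
  \<comment> \<open>For \<open>i < j\<close> the factors of both steps convert the factor of
    \<open>psi'\<close> at \<open>l\<close> into the one at \<open>b\<close>.\<close>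
  have head: "C i * D i * E i * G l i = G b i" if i: "i \<in> {1..<j}" for i
  proof -
    have nz: "1 - q powi (l i - l j - 1) * t ^ (j - i) \<noteq> 0" "1 - q powi (l i - l j) * t ^ (j - i - 1) \<noteq> 0"
        "1 - q powi (l i - l j) * t ^ (j - i) \<noteq> 0" "1 - q powi (l i - l j - 1) * t ^ (j - i + 1) \<noteq> 0"
      using up[OF i] i by (intro monomial_neq_1; simp)+
    have "x1 / x2 * (y2 / y1) * (y4 / y3) * (x3 / x4) * (x2 * x4 / (x3 * x1)) = y2 * y4 / (y3 * y1)"
      if "x1 \<noteq> 0" "x2 \<noteq> 0" "x3 \<noteq> 0" "x4 \<noteq> 0" for x1 x2 x3 x4 y1 y2 y3 y4 :: real
      using that by simp
    from this[OF nz] show ?thesis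
      unfolding C_def D_def E_def G_def eq .
  qed
  have "psi' q t k l j = (\<Prod>i\<in>{1..<j}. G l i)" "psi' q t (k - 1) b j = (\<Prod>i\<in>{1..<j}. G b i)"
    using GT by (simp_all add: psi'_def G_def)
  moreover have "(\<Prod>i\<in>{1..<j}. G b i) =
      (\<Prod>i\<in>{1..<j}. C i) * (\<Prod>i\<in>{1..<j}. D i) * (\<Prod>i\<in>{1..<j}. E i) * (\<Prod>i\<in>{1..<j}. G l i)"
    unfolding prod.distrib[symmetric] by (intro prod.cong refl head[symmetric])
  ultimately have "psi q t k (l + e j) (b + e j) * psi' q t k l j = psi q t k l b * psi' q t (k - 1) b j *
      ((\<Prod>n\<in>{j..<k}. A n * B n) * ((\<Prod>n\<in>{j<..<k}. 1 / B n) * (\<Prod>n\<in>{j..<k}. 1 / A n) * (1 / B j)))"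
    unfolding lower upper by (simp only: mult_ac)
  then show ?thesis unfolding tail by simp
qed

end

section \<open>Partial fractions and the sum rule for generic parameters\<close>

text \<open>Induction on the number of factors of the numerator, via the Leibniz rule
  \<open>[p\<^sub>i; i \<in> A](z - c) g = [p\<^sub>i; i \<in> A - {a}] g + (p\<^sub>a - c) [p\<^sub>i; i \<in> A] g\<close> for divided differences.\<close>

lemma divided_difference_prod:
  fixes p n :: "'a \<Rightarrow> real"
  assumes "finite B" "finite A" "inj_on p A" "card B < card A"
  shows "(\<Sum>i\<in>A. (\<Prod>m\<in>B. p i - n m) / (\<Prod>m\<in>A - {i}. p i - p m)) = (if card A = Suc (card B) then 1 else 0)"
  using assms
proof (induction B arbitrary: A rule: finite_induct)
  have *: "(\<Sum>i\<in>A. (p i - c) * g i / (\<Prod>m\<in>A - {i}. p i - p m)) =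
      (\<Sum>i\<in>A - {a}. g i / (\<Prod>m\<in>A - {a} - {i}. p i - p m)) +
      (p a - c) * (\<Sum>i\<in>A. g i / (\<Prod>m\<in>A - {i}. p i - p m))"
    if A: "finite A" "inj_on p A" "a \<in> A" for A a c g
  proof -
    have "(\<Sum>i\<in>A. (p i - c) * g i / (\<Prod>m\<in>A - {i}. p i - p m)) =
      (\<Sum>i\<in>A. (p i - p a) * g i / (\<Prod>m\<in>A - {i}. p i - p m)) +
      (\<Sum>i\<in>A. (p a - c) * (g i / (\<Prod>m\<in>A - {i}. p i - p m)))"
      unfolding sum.distrib[symmetric]
      by (intro sum.cong refl) (simp add: add_divide_distrib[symmetric] algebra_simps)
    also have "(\<Sum>i\<in>A. (p i - p a) * g i / (\<Prod>m\<in>A - {i}. p i - p m)) =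
      (\<Sum>i\<in>A - {a}. g i / (\<Prod>m\<in>A - {a} - {i}. p i - p m))"
    proof (intro sum.mono_neutral_cong_right ballI)
      fix i assume i: "i \<in> A - {a}"
      then have "(\<Prod>m\<in>A - {i}. p i - p m) = (p i - p a) * (\<Prod>m\<in>A - {i} - {a}. p i - p m)"
        using A by (intro prod.remove) auto
      moreover have "p i \<noteq> p a" using A i by (auto dest: inj_onD)
      moreover have "A - {i} - {a} = A - {a} - {i}" by auto
      ultimately show "(p i - p a) * g i / (\<Prod>m\<in>A - {i}. p i - p m) = g i / (\<Prod>m\<in>A - {a} - {i}. p i - p m)"
        by simp
    qed (use A in auto)
    finally show ?thesis by (simp add: sum_distrib_left)
  qed
  {
    case empty
    have "(\<Sum>i\<in>A. 1 / (\<Prod>m\<in>A - {i}. p i - p m)) = (if card A = 1 then 1 else 0)"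
      if "finite A" "inj_on p A" "A \<noteq> {}" for A
      using that
    proof (induction "card A" arbitrary: A rule: less_induct)
      case less
      then obtain a where a: "a \<in> A" by auto
      show ?case
      proof (cases "A = {a}")
        case False
        then obtain b where b: "b \<in> A" "b \<noteq> a" using a by auto
        let ?L = "\<lambda>A. \<Sum>i\<in>A. 1 / (\<Prod>m\<in>A - {i}. p i - p m)"
        have card: "card A \<ge> 2" using a b less.prems card_mono[of A "{a, b}"] by auto
        have ih: "?L (A - {x}) = (if card (A - {x}) = 1 then 1 else 0)" if "x \<in> A" for x
          using that less.prems card by (intro less.hyps) (auto simp: inj_on_diff card_gt_0_iff subset_singleton_iff)
        \<comment> \<open>The same left side is expanded at the two nodes \<open>a\<close> and
          \<open>b\<close>; any common constant in place of \<open>p b - 1\<close> would do. The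
          sums over \<open>A - {a}\<close> and \<open>A - {b}\<close> agree because by induction
          they depend only on the cardinality, so subtraction leaves \<open>p a - p b\<close> times
          the wanted sum.\<close>
        have "(\<Sum>i\<in>A. (p i - (p b - 1)) * 1 / (\<Prod>m\<in>A - {i}. p i - p m)) = ?L (A - {a}) + (p a - (p b - 1)) * ?L A"
          using *[of A a "p b - 1" "\<lambda>_. 1"] less.prems a by simp
        moreover have "(\<Sum>i\<in>A. (p i - (p b - 1)) * 1 / (\<Prod>m\<in>A - {i}. p i - p m)) = ?L (A - {b}) + (p b - (p b - 1)) * ?L A"
          using *[of A b "p b - 1" "\<lambda>_. 1"] less.prems b by simp
        moreover have "?L (A - {a}) = ?L (A - {b})"
          using ih[OF a] ih[OF b(1)] a b less.prems by simp
        ultimately have "(p a - p b) * ?L A = 0" by (simp only: left_diff_distrib)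
        moreover have "p a \<noteq> p b" using a b less.prems by (auto dest: inj_onD)
        ultimately show ?thesis using card by simp
      qed simp
    qed
    from this[OF empty(1,2)] empty show ?case by (cases "A = {}") auto
  next
    case (insert c B)
    then obtain a where a: "a \<in> A" by fastforce
    have "(\<Sum>i\<in>A. (\<Prod>m\<in>insert c B. p i - n m) / (\<Prod>m\<in>A - {i}. p i - p m)) =
        (\<Sum>i\<in>A - {a}. (\<Prod>m\<in>B. p i - n m) / (\<Prod>m\<in>A - {a} - {i}. p i - p m)) +
        (p a - n c) * (\<Sum>i\<in>A. (\<Prod>m\<in>B. p i - n m) / (\<Prod>m\<in>A - {i}. p i - p m))"
      using *[of A a "n c" "\<lambda>i. \<Prod>m\<in>B. p i - n m"] insert a by simp
    also have "(\<Sum>i\<in>A. (\<Prod>m\<in>B. p i - n m) / (\<Prod>m\<in>A - {i}. p i - p m)) = 0"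
      using insert by (subst insert.IH) auto
    also have "(\<Sum>i\<in>A - {a}. (\<Prod>m\<in>B. p i - n m) / (\<Prod>m\<in>A - {a} - {i}. p i - p m)) =
        (if card (A - {a}) = Suc (card B) then 1 else 0)"
      using insert a by (intro insert.IH) (auto simp: inj_on_diff)
    finally show ?case using insert a by auto
  }
qed

text \<open>The point 0 is adjoined as a further node \<open>None\<close>. The numerator then has
  degree one less than the number of nodes, so the divided difference is 1; the node 0 contributes
  the product of the \<open>n i / p i\<close>. This is the residue theorem for the product of the
  \<open>(z - n i) / (z - p i)\<close> times \<open>dz / z\<close>.\<close>

lemma partial_fractions_at_0:
  fixes p n :: "'a \<Rightarrow> real"
  assumes "finite I" "inj_on p I" "\<And>i. i \<in> I \<Longrightarrow> p i \<noteq> 0"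
  shows "(\<Sum>i\<in>I. (1 - n i / p i) * (\<Prod>m\<in>I - {i}. (p i - n m) / (p i - p m))) = 1 - (\<Prod>i\<in>I. n i / p i)"
proof -
  let ?p = "case_option 0 p" and ?n = "case_option 0 n"
  have inj: "inj_on ?p (insert None (Some ` I))"
    using assms by (auto simp: inj_on_def)
  have I: "insert None (Some ` I) - {None} = Some ` I" by auto
  have Ii: "insert None (Some ` I) - {Some i} = insert None (Some ` (I - {i}))" for i by auto
  have "1 = (\<Sum>i\<in>insert None (Some ` I). (\<Prod>m\<in>Some ` I. ?p i - ?n m) / (\<Prod>m\<in>insert None (Some ` I) - {i}. ?p i - ?p m))"
    using assms inj by (subst divided_difference_prod) (auto simp: card_image)
  also have "\<dots> = (\<Prod>i\<in>I. n i / p i) + (\<Sum>i\<in>I. (\<Prod>m\<in>I. p i - n m) / (\<Prod>m\<in>insert None (Some ` (I - {i})). p i - ?p m))"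
    using assms by (subst sum.insert) (auto simp: I Ii sum.reindex prod.reindex prod_dividef[symmetric])
  also have "(\<Sum>i\<in>I. (\<Prod>m\<in>I. p i - n m) / (\<Prod>m\<in>insert None (Some ` (I - {i})). p i - ?p m)) =
    (\<Sum>i\<in>I. (1 - n i / p i) * (\<Prod>m\<in>I - {i}. (p i - n m) / (p i - p m)))"
  proof (intro sum.cong refl)
    fix i assume i: "i \<in> I"
    have "(\<Prod>m\<in>I. p i - n m) = (p i - n i) * (\<Prod>m\<in>I - {i}. p i - n m)"
      using i assms by (intro prod.remove) auto
    moreover have "(\<Prod>m\<in>insert None (Some ` (I - {i})). p i - ?p m) = p i * (\<Prod>m\<in>I - {i}. p i - p m)"
      using assms by (subst prod.insert) (auto simp: prod.reindex)
    moreover have "1 - n i / p i = (p i - n i) / p i"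
      using assms(3)[OF i] by (simp add: diff_divide_distrib)
    ultimately show "(\<Prod>m\<in>I. p i - n m) / (\<Prod>m\<in>insert None (Some ` (I - {i})). p i - ?p m) =
        (1 - n i / p i) * (\<Prod>m\<in>I - {i}. (p i - n m) / (p i - p m))"
      by (simp add: prod_dividef)
  qed
  finally show ?thesis by simp
qed

lemma quotient_factor:
  fixes u v c d :: real
  assumes "v \<noteq> 0"
  shows "(1 - c * (u / v)) / (1 - d * (u / v)) = (v - c * u) / (v - d * u)"
proof -
  have "1 - c * (u / v) = (v - c * u) / v" "1 - d * (u / v) = (v - d * u) / v"
    using assms by (simp_all add: diff_divide_distrib)
  then show ?thesis using assms by simp
qed

text \<open>Serves the factors whose indices are in the opposite order. The price of turning the
  ratio around is the constant \<open>c / d\<close>, which has to be tracked.\<close>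

lemma quotient_factor_inverse:
  fixes u v c d :: real
  assumes "u \<noteq> 0" "c \<noteq> 0" "d \<noteq> 0"
  shows "(1 - c * (v / u)) / (1 - d * (v / u)) = (c / d) * ((v - u / c) / (v - u / d))"
proof -
  have "1 - c * (v / u) = - c / u * (v - u / c)" "1 - d * (v / u) = - d / u * (v - u / d)"
    using assms by (simp_all add: field_simps)
  then show ?thesis using assms by simp
qed

text \<open>The hypothesis \<open>generic\<close> serves twice: it separates the poles
  \<open>x j\<close> from the poles \<open>y n / q\<close>, and its case \<open>m = 1\<close> makes
  the common factor \<open>1 - t / q\<close> of all residues nonzero.\<close>

lemma sum_S_prod_generic:
  fixes q t :: real
  assumes il: "interlace k b l" and k: "k \<ge> 1"
    and q: "0 < q" "q < 1" and t: "0 < t" "t < 1"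
    and generic: "\<And>m. m \<in> {1..k} \<Longrightarrow> t ^ m \<noteq> q"
  shows "(\<Sum>j\<in>{1..k}. S_prod q t k b l j) = 1 + (\<Sum>j\<in>{1..<k}. T_prod q t k b l j)"
proof -
  have q0: "0 \<le> q" and t0: "0 \<le> t" using q t by auto
  have GT: "b \<in> GT (k - 1)" "l \<in> GT k" using il by (auto simp: interlace_def)
  define x where "x = (\<lambda>j. q powi l j / t ^ j)"
  define y where "y = (\<lambda>j. q powi b j / t ^ j)"
  have pos: "x j > 0" "y j > 0" for j using q t by (simp_all add: x_def y_def)
  then have nz: "x j \<noteq> 0" "y j \<noteq> 0" for j by (metis less_irrefl)+
  have mon: "q powi (u - v) * t ^ (j - i) = (q powi u / t ^ i) / (q powi v / t ^ j)" if "i \<le> j" for u v i j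
    using q t that by (simp add: power_int_diff power_diff)
  have mon_p: "q powi (u - v + 1) * t ^ n = q * (q powi (u - v) * t ^ n)"
    and mon_m: "q powi (u - v - 1) * t ^ n = 1 / q * (q powi (u - v) * t ^ n)" for u v n
    using q by (simp_all add: power_int_diff power_int_add)
  \<comment> \<open>The factors \<open>\<alpha>\<close>, \<open>\<beta>\<close> belong to the
    residue at \<open>x j\<close>, and \<open>\<gamma>\<close>, \<open>\<delta>\<close> to the
    residue at \<open>y j / q\<close>, where numerator and denominator have been multiplied by
    \<open>q\<close>.\<close>
  define \<alpha> where "\<alpha> = (\<lambda>j m. (x j - t / q * x m) / (x j - x m))"
  define \<beta> where "\<beta> = (\<lambda>j n. (x j - y n / t) / (x j - y n / q))"
  define \<gamma> where "\<gamma> = (\<lambda>j n. (y j - q / t * y n) / (y j - y n))"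
  define \<delta> where "\<delta> = (\<lambda>j m. (y j - t * x m) / (y j - q * x m))"

  have S: "S_prod q t k b l j = (\<Prod>m\<in>{1..k} - {j}. \<alpha> j m) * (\<Prod>n\<in>{1..<k}. \<beta> j n)" if j: "j \<in> {1..k}" for j
  proof -
    have 1: "(1 - q powi (l i - l j - 1) * t ^ (j - i + 1)) / (1 - q powi (l i - l j) * t ^ (j - i)) = \<alpha> j i"
      "(1 - q powi (b i - l j) * t ^ (j - i - 1)) / (1 - q powi (b i - l j - 1) * t ^ (j - i)) = \<beta> j i"
      if i: "i \<in> {1..<j}" for i
    proof -
      have t1: "t ^ (j - i - 1) = 1 / t * t ^ (j - i)" using i t by (simp add: power_diff)
      have "q powi (l i - l j) * t ^ (j - i) = x i / x j" "q powi (b i - l j) * t ^ (j - i) = y i / x j"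
        unfolding x_def y_def using i by (intro mon; simp)+
      then show "(1 - q powi (l i - l j - 1) * t ^ (j - i + 1)) / (1 - q powi (l i - l j) * t ^ (j - i)) = \<alpha> j i"
        "(1 - q powi (b i - l j) * t ^ (j - i - 1)) / (1 - q powi (b i - l j - 1) * t ^ (j - i)) = \<beta> j i"
        using quotient_factor[of "x j" "t / q" "x i" 1] quotient_factor[of "x j" "1 / t" "y i" "1 / q"] nz
        unfolding t1 mon_m \<alpha>_def \<beta>_def by (simp_all add: mult_ac)
    qed
    \<comment> \<open>Pairing \<open>l (n + 1)\<close> with \<open>b n\<close> makes the constants
      \<open>q / t\<close> and \<open>t / q\<close> from the inversion cancel.\<close>
    have 2: "((1 - q powi (l j - l (n + 1) + 1) * t ^ (n - j)) / (1 - q powi (l j - l (n + 1)) * t ^ (n - j + 1))) *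
        ((1 - q powi (l j - b n) * t ^ (n - j + 1)) / (1 - q powi (l j - b n + 1) * t ^ (n - j))) = \<alpha> j (Suc n) * \<beta> j n"
      if n: "n \<in> {j..<k}" for n
    proof -
      have t1: "t ^ (n - j) = 1 / t * t ^ (Suc n - j)" using n t by (simp add: Suc_diff_le)
      have m: "q powi (l j - l (Suc n)) * t ^ (Suc n - j) = x j / x (Suc n)" "q powi (l j - b n) * t ^ (n - j) = x j / y n"
        unfolding x_def y_def using n by (intro mon; simp)+
      have m': "q powi (l j - l (n + 1)) * t ^ (n - j) = 1 / t * (x j / x (Suc n))"
        unfolding t1 using m(1) by simp
      have m'': "q powi (l j - l (n + 1)) * t ^ (n - j + 1) = x j / x (Suc n)"
        using m(1) n by (simp add: Suc_diff_le)
      have "(1 - q powi (l j - l (n + 1) + 1) * t ^ (n - j)) / (1 - q powi (l j - l (n + 1)) * t ^ (n - j + 1)) = q / t * \<alpha> j (Suc n)"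
        using quotient_factor_inverse[of "x (Suc n)" "q / t" 1 "x j"] nz q t
        unfolding mon_p m' m'' \<alpha>_def by simp
      moreover have "(1 - q powi (l j - b n) * t ^ (n - j + 1)) / (1 - q powi (l j - b n + 1) * t ^ (n - j)) = t / q * \<beta> j n"
        using quotient_factor_inverse[of "y n" t q "x j"] nz q t m(2)
        unfolding mon_p \<beta>_def by (simp add: mult_ac)
      ultimately show ?thesis using q t by simp
    qed
    have "S_prod q t k b l j = (\<Prod>i\<in>{1..<j}. \<alpha> j i * \<beta> j i) * (\<Prod>n\<in>{j..<k}. \<alpha> j (Suc n) * \<beta> j n)"
      unfolding S_prod_def
      by (rule arg_cong2[where f = "(*)"]; rule prod.cong[OF refl]) (simp_all only: 1 2)
    also have "\<dots> = ((\<Prod>i\<in>{1..<j}. \<alpha> j i) * (\<Prod>n\<in>{j..<k}. \<alpha> j (Suc n))) * ((\<Prod>i\<in>{1..<j}. \<beta> j i) * (\<Prod>n\<in>{j..<k}. \<beta> j n))"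
      by (simp add: prod.distrib)
    also have "(\<Prod>n\<in>{j..<k}. \<alpha> j (Suc n)) = (\<Prod>m\<in>{j<..k}. \<alpha> j m)"
      by (rule prod.reindex_bij_witness[where i = "\<lambda>m. m - 1" and j = Suc]) auto
    also have "(\<Prod>i\<in>{1..<j}. \<alpha> j i) * (\<Prod>m\<in>{j<..k}. \<alpha> j m) = (\<Prod>m\<in>{1..k} - {j}. \<alpha> j m)"
      using j by (subst prod.union_disjoint[symmetric]) (auto intro!: prod.cong)
    also have "(\<Prod>i\<in>{1..<j}. \<beta> j i) * (\<Prod>n\<in>{j..<k}. \<beta> j n) = (\<Prod>n\<in>{1..<k}. \<beta> j n)"
      using j by (subst prod.union_disjoint[symmetric]) (auto intro!: prod.cong)
    finally show ?thesis .
  qed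

  have T: "T_prod q t k b l j = q / t * ((\<Prod>n\<in>{1..<k} - {j}. \<gamma> j n) * (\<Prod>m\<in>{1..k}. \<delta> j m))" if j: "j \<in> {1..<k}" for j
  proof -
    have 1: "(1 - q powi (b j - b n - 1) * t ^ (n - j + 1)) / (1 - q powi (b j - b n) * t ^ (n - j)) = t / q * \<gamma> j n"
      if n: "n \<in> {j<..<k}" for n
    proof -
      have "q powi (b j - b n) * t ^ (n - j) = y j / y n"
        unfolding y_def using n by (intro mon) auto
      then show ?thesis
        using quotient_factor_inverse[of "y n" "t / q" 1 "y j"] nz q t
        unfolding mon_m \<gamma>_def by (simp add: mult_ac)
    qed
    have 2: "(1 - q powi (b j - l (n + 1)) * t ^ (n - j)) / (1 - q powi (b j - l (n + 1) - 1) * t ^ (n - j + 1)) = q / t * \<delta> j (Suc n)"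
      if n: "n \<in> {j..<k}" for n
    proof -
      have t1: "t ^ (n - j) = 1 / t * t ^ (Suc n - j)" using n t by (simp add: Suc_diff_le)
      have m: "q powi (b j - l (Suc n)) * t ^ (Suc n - j) = y j / x (Suc n)"
        unfolding x_def y_def using n by (intro mon) auto
      have m': "q powi (b j - l (n + 1)) * t ^ (n - j) = 1 / t * (y j / x (Suc n))"
        unfolding t1 using m by simp
      have m'': "q powi (b j - l (n + 1)) * t ^ (n - j + 1) = y j / x (Suc n)"
        using m n by (simp add: Suc_diff_le)
      show ?thesis
        using quotient_factor_inverse[of "x (Suc n)" "1 / t" "1 / q" "y j"] nz q t
        unfolding mon_m m' m'' \<delta>_def by (simp add: mult_ac)
    qed
    have 3: "(1 - q powi (b i - b j + 1) * t ^ (j - i - 1)) / (1 - q powi (b i - b j) * t ^ (j - i)) = \<gamma> j i"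
      if i: "i \<in> {1..<j}" for i
    proof -
      have t1: "t ^ (j - i - 1) = 1 / t * t ^ (j - i)" using i t by (simp add: power_diff)
      have "q powi (b i - b j) * t ^ (j - i) = y i / y j"
        unfolding y_def using i by (intro mon) auto
      then show ?thesis
        using quotient_factor[of "y j" "q / t" "y i" 1] nz
        unfolding mon_p unfolding t1 \<gamma>_def by (simp add: mult_ac)
    qed
    have 4: "(1 - q powi (l i - b j) * t ^ (j - i + 1)) / (1 - q powi (l i - b j + 1) * t ^ (j - i)) = \<delta> j i"
      if i: "i \<in> {1..j}" for i
    proof -
      have "q powi (l i - b j) * t ^ (j - i) = x i / y j"
        unfolding x_def y_def using i by (intro mon) auto
      then show ?thesis
        using quotient_factor[of "y j" t "x i" q] nz
        unfolding mon_p \<delta>_def by (simp add: mult_ac)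
    qed
    have "T_prod q t k b l j = (\<Prod>n\<in>{j<..<k}. t / q * \<gamma> j n) * (\<Prod>n\<in>{j..<k}. q / t * \<delta> j (Suc n)) *
        (\<Prod>i\<in>{1..<j}. \<gamma> j i) * (\<Prod>i\<in>{1..j}. \<delta> j i)"
      unfolding T_prod_def
      by ((rule arg_cong2[where f = "(*)"])+; rule prod.cong[OF refl]) (simp_all only: 1 2 3 4)
    also have "\<dots> = ((t / q) ^ (k - Suc j) * (q / t) ^ (k - j)) *
        (((\<Prod>i\<in>{1..<j}. \<gamma> j i) * (\<Prod>n\<in>{j<..<k}. \<gamma> j n)) * ((\<Prod>i\<in>{1..j}. \<delta> j i) * (\<Prod>n\<in>{j..<k}. \<delta> j (Suc n))))"
      by (simp only: prod.distrib prod_constant card_greaterThanLessThan card_atLeastLessThan mult_ac)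
    also have "(\<Prod>n\<in>{j..<k}. \<delta> j (Suc n)) = (\<Prod>m\<in>{j<..k}. \<delta> j m)"
      by (rule prod.reindex_bij_witness[where i = "\<lambda>m. m - 1" and j = Suc]) auto
    also have "(\<Prod>i\<in>{1..j}. \<delta> j i) * (\<Prod>m\<in>{j<..k}. \<delta> j m) = (\<Prod>m\<in>{1..k}. \<delta> j m)"
      using j by (subst prod.union_disjoint[symmetric]) (auto intro!: prod.cong)
    also have "(\<Prod>i\<in>{1..<j}. \<gamma> j i) * (\<Prod>n\<in>{j<..<k}. \<gamma> j n) = (\<Prod>n\<in>{1..<k} - {j}. \<gamma> j n)"
      using j by (subst prod.union_disjoint[symmetric]) (auto intro!: prod.cong)
    \<comment> \<open>After the index \<open>j\<close> there is one more factor
      \<open>\<delta>\<close> than factors \<open>\<gamma>\<close>, so exactly one constant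
      \<open>q / t\<close> survives.\<close>
    also have "(t / q) ^ (k - Suc j) * (q / t) ^ (k - j) = q / t"
    proof -
      have "k - j = Suc (k - Suc j)" using j by auto
      then have "(t / q) ^ (k - Suc j) * (q / t) ^ (k - j) = q / t * ((t / q) * (q / t)) ^ (k - Suc j)"
        by (simp only: power_Suc power_mult_distrib mult_ac)
      then show ?thesis using q t by simp
    qed
    finally show ?thesis .
  qed

  \<comment> \<open>The disjoint sum indexes both families of poles \<open>p\<close>; each pole is
    paired with a zero \<open>z\<close> that is a constant multiple of it, with ratio
    \<open>t / q\<close> on the left and \<open>q / t\<close> on the right.\<close>
  define I where "I = {1..k} <+> {1..<k}"
  define p where "p = case_sum x (\<lambda>n. y n / q)"
  define z where "z = case_sum (\<lambda>j. t / q * x j) (\<lambda>n. y n / t)"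
  have less1: "q powi u * t ^ n \<noteq> 1" if "u \<ge> 0" "u > 0 \<or> n > 0" for u n
    using monomial_less_1[OF q0 q(2) t0 t(2) that] by simp
  have x_inj: "x i \<noteq> x j" if "1 \<le> i" "i < j" "j \<le> k" for i j
  proof -
    have "q powi (l i - l j) * t ^ (j - i) \<noteq> 1"
      using antimono_GT[OF GT(2), of i j] that by (intro less1) auto
    then have "x i / x j \<noteq> 1" using mon[of i j "l i" "l j"] that by (simp add: x_def)
    then show ?thesis using nz by auto
  qed
  have y_inj: "y i \<noteq> y j" if "1 \<le> i" "i < j" "j < k" for i j
  proof -
    have "q powi (b i - b j) * t ^ (j - i) \<noteq> 1"
      using antimono_GT[OF GT(1), of i j] that by (intro less1) auto
    then have "y i / y j \<noteq> 1" using mon[of i j "b i" "b j"] that by (simp add: y_def)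
    then show ?thesis using nz by auto
  qed
  have xy: "x j \<noteq> y n / q" if jn: "1 \<le> j" "j \<le> k" "1 \<le> n" "n < k" for j n
  proof (cases "j \<le> n")
    case True
    have "q powi (l j - b n + 1) * t ^ (n - j) \<noteq> 1"
      using interlace_upper[OF il, of j n] jn True by (intro less1) auto
    then have "q * (x j / y n) \<noteq> 1"
      unfolding mon_p using mon[OF True, of "l j" "b n"] by (simp add: x_def y_def)
    then show ?thesis using nz q by (auto simp: field_simps)
  next
    case False
    \<comment> \<open>The exponent is -1 when \<open>b n = l j\<close>. The two poles then coincide
      exactly for \<open>t ^ (j - n) = q\<close>, which \<open>generic\<close> excludes.\<close>
    have "q powi (b n - l j - 1) * t ^ (j - n) \<noteq> 1"
    proof (cases "b n = l j")
      case True
      have "j - n \<in> {1..k}" using jn False by auto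
      from generic[OF this] show ?thesis using True q by (simp add: power_int_minus field_simps)
    next
      case neq: False
      then show ?thesis using interlace_lower[OF il, of n j] jn False by (intro less1) auto
    qed
    then have "1 / q * (y n / x j) \<noteq> 1"
      unfolding mon_m using mon[of n j "b n" "l j"] False by (simp add: x_def y_def)
    then show ?thesis using nz q by (auto simp: field_simps)
  qed
  have inj: "inj_on p I"
  proof (rule inj_onI)
    have x_eq: "i = j" if "x i = x j" "i \<in> {1..k}" "j \<in> {1..k}" for i j
      using x_inj[of i j] x_inj[of j i] that by (cases i j rule: linorder_cases) auto
    have y_eq: "i = j" if "y i / q = y j / q" "i \<in> {1..<k}" "j \<in> {1..<k}" for i j
      using y_inj[of i j] y_inj[of j i] that q by (cases i j rule: linorder_cases) auto
    have xy_neq: "x j \<noteq> y n / q" "y n / q \<noteq> x j" if "j \<in> {1..k}" "n \<in> {1..<k}" for j n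
      using xy[of j n] that by auto
    fix i j assume "i \<in> I" "j \<in> I" "p i = p j"
    then show "i = j"
      unfolding I_def p_def
      by (cases i; cases j) (use x_eq y_eq xy_neq in \<open>auto simp del: divide_cancel_right\<close>)
  qed
  have nz_p: "p i \<noteq> 0" for i using nz q by (auto simp: p_def split: sum.split)
  have IL: "I - {Inl j} = ({1..k} - {j}) <+> {1..<k}" and IR: "I - {Inr j} = {1..k} <+> ({1..<k} - {j})" for j
    by (auto simp: I_def)
  have pf: "(\<Sum>i\<in>I. (1 - z i / p i) * (\<Prod>m\<in>I - {i}. (p i - z m) / (p i - p m))) = 1 - (\<Prod>i\<in>I. z i / p i)"
    by (rule partial_fractions_at_0) (use inj nz_p in \<open>auto simp: I_def\<close>)
  have resL: "(1 - z (Inl j) / p (Inl j)) * (\<Prod>m\<in>I - {Inl j}. (p (Inl j) - z m) / (p (Inl j) - p m)) =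
      (1 - t / q) * S_prod q t k b l j" if "j \<in> {1..k}" for j
    unfolding IL S[OF that] using nz by (simp add: prod.Plus z_def p_def \<alpha>_def \<beta>_def)
  have scale: "(u / q - v / q) / (u / q - w / q) = (u - v) / (u - w)" for u v w
    using q by (simp add: diff_divide_distrib[symmetric])
  have resR: "(1 - z (Inr j) / p (Inr j)) * (\<Prod>m\<in>I - {Inr j}. (p (Inr j) - z m) / (p (Inr j) - p m)) =
      - ((1 - t / q) * T_prod q t k b l j)" if "j \<in> {1..<k}" for j
  proof -
    have "(y j / q - t / q * x m) / (y j / q - x m) = \<delta> j m" "(y j / q - y m / t) / (y j / q - y m / q) = \<gamma> j m" for m
      using scale[of "y j" "t * x m" "q * x m"] scale[of "y j" "q / t * y m" "y m"] q by (simp_all add: \<gamma>_def \<delta>_def)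
    then have "(\<Prod>m\<in>I - {Inr j}. (p (Inr j) - z m) / (p (Inr j) - p m)) = (\<Prod>n\<in>{1..<k} - {j}. \<gamma> j n) * (\<Prod>m\<in>{1..k}. \<delta> j m)"
      unfolding IR by (simp add: prod.Plus z_def p_def)
    \<comment> \<open>The constant \<open>q / t\<close> in this prefactor is the one contained in
      \<open>T_prod\<close>; the sign puts \<open>T\<close> on the other side of the
      identity.\<close>
    moreover have "1 - z (Inr j) / p (Inr j) = - ((1 - t / q) * (q / t))"
      using nz q t by (simp add: z_def p_def field_simps)
    ultimately show ?thesis unfolding T[OF that] by (simp only: mult_ac mult_minus_left mult_minus_right)
  qed
  have "(\<Prod>i\<in>I. z i / p i) = (t / q) ^ k * (q / t) ^ (k - 1)"
    unfolding I_def using nz by (simp add: prod.Plus z_def p_def)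
  also have "\<dots> = t / q * ((t / q) * (q / t)) ^ (k - 1)"
    using k by (simp only: power_eq_if[of "t / q" k] power_mult_distrib mult_ac split: if_split) simp
  finally have prod: "(\<Prod>i\<in>I. z i / p i) = t / q" using q t by simp
  have "(1 - t / q) * ((\<Sum>j\<in>{1..k}. S_prod q t k b l j) - (\<Sum>j\<in>{1..<k}. T_prod q t k b l j)) = (1 - t / q) * 1"
  proof -
    define R where "R = (\<lambda>i. (1 - z i / p i) * (\<Prod>m\<in>I - {i}. (p i - z m) / (p i - p m)))"
    have "sum R I = (\<Sum>j\<in>{1..k}. R (Inl j)) + (\<Sum>j\<in>{1..<k}. R (Inr j))"
      unfolding I_def by (simp add: sum.Plus)
    also have "(\<Sum>j\<in>{1..k}. R (Inl j)) = (\<Sum>j\<in>{1..k}. (1 - t / q) * S_prod q t k b l j)"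
      unfolding R_def by (rule sum.cong[OF refl resL])
    also have "(\<Sum>j\<in>{1..<k}. R (Inr j)) = (\<Sum>j\<in>{1..<k}. - ((1 - t / q) * T_prod q t k b l j))"
      unfolding R_def by (rule sum.cong[OF refl resR])
    finally show ?thesis
      using pf unfolding R_def prod by (simp add: sum_distrib_left sum_negf right_diff_distrib)
  qed
  moreover have "1 - t / q \<noteq> 0" using generic[of 1] k q by auto
  ultimately show ?thesis unfolding mult_left_cancel[OF \<open>1 - t / q \<noteq> 0\<close>] by simp
qed

section \<open>Admissible moves and the sum rule for all parameters\<close>

text \<open>A nonnegative exponent turns the integer power into a natural one, so continuity holds
  at \<open>q = 0\<close> as well.\<close>

lemma tendsto_monomial:
  fixes q t :: real
  assumes "(g \<longlongrightarrow> q) G" "(h \<longlongrightarrow> t) G" "0 \<le> u"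
  shows "((\<lambda>s. g s powi u * h s ^ n) \<longlongrightarrow> q powi u * t ^ n) G"
  unfolding power_int_nonneg_exp[OF assms(3)] by (intro tendsto_intros assms)

text \<open>Raising \<open>l j\<close> can only collide with \<open>b (j - 1)\<close>, and
  \<open>F\<close> collects the indices where there is room. The index 1 has no such
  neighbour.\<close>

lemma interlace_add_iff:
  assumes "interlace k b l" "j \<in> {1..k}"
  shows "interlace k b (l + e j) \<longleftrightarrow> j \<in> F k b l"
proof
  assume *: "interlace k b (l + e j)"
  show "j \<in> F k b l"
  proof (cases "j = 1")
    case False
    then have "j - 1 \<in> {1..k - 1}" "j - 1 + 1 = j" using assms(2) by auto
    then have "(l + e j) j \<le> b (j - 1)" using * unfolding interlace_def by metis
    then show ?thesis using assms(2) by (simp add: F_def e_def)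
  qed (use assms(2) in \<open>simp add: F_def\<close>)
next
  assume j: "j \<in> F k b l"
  have ub: "(l + e j) (i + 1) \<le> b i" if "i \<in> {1..k - 1}" for i
    using assms(1) j that by (auto simp: interlace_def F_def e_def)
  moreover have lb: "b i \<le> (l + e j) i" if "i \<in> {1..k - 1}" for i
  proof -
    have "b i \<le> l i" using assms(1) that by (simp add: interlace_def)
    then show ?thesis by (auto simp: e_def)
  qed
  moreover have "(l + e j) i = 0" if "i \<notin> {1..k}" for i
    using assms that by (auto simp: interlace_def GT_def e_def)
  moreover have "(l + e j) (i + 1) \<le> (l + e j) i" if "i \<in> {1..<k}" for i
    using ub[of i] lb[of i] that by force
  ultimately show "interlace k b (l + e j)"
    using assms(1) by (auto simp: interlace_def GT_def)
qed

text \<open>The gap \<open>l (j + 1) < b j\<close> that lets \<open>b j\<close> go down is the one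
  that lets \<open>l (j + 1)\<close> go up, hence the shift of the index by one.\<close>

lemma interlace_diff_iff:
  assumes "interlace k b l" "j \<in> {1..<k}"
  shows "interlace k (b - e j) l \<longleftrightarrow> j + 1 \<in> F k b l"
proof
  assume "interlace k (b - e j) l"
  then have "l (j + 1) \<le> (b - e j) j" using assms(2) by (auto simp: interlace_def)
  then show "j + 1 \<in> F k b l" using assms(2) by (simp add: F_def e_def)
next
  assume "j + 1 \<in> F k b l"
  then have j: "l (j + 1) < b j" using assms(2) by (auto simp: F_def)
  have ub: "l (i + 1) \<le> (b - e j) i" if "i \<in> {1..k - 1}" for i
    using assms(1) j that by (auto simp: interlace_def F_def e_def)
  moreover have lb: "(b - e j) i \<le> l i" if "i \<in> {1..k - 1}" for i
  proof -
    have "b i \<le> l i" using assms(1) that by (simp add: interlace_def)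
    then show ?thesis by (auto simp: e_def)
  qed
  moreover have "(b - e j) i = 0" if "i \<notin> {1..k - 1}" for i
    using assms that by (auto simp: interlace_def GT_def e_def)
  moreover have "(b - e j) (i + 1) \<le> (b - e j) i" if "i \<in> {1..<k - 1}" for i
  proof -
    have "i \<in> {1..k - 1}" "i + 1 \<in> {1..k - 1}" using that by auto
    then show ?thesis using ub[of i] lb[of "i + 1"] by linarith
  qed
  ultimately show "interlace k (b - e j) l"
    using assms(1) by (auto simp: interlace_def GT_def)
qed

context
  fixes k :: nat and b l :: "nat \<Rightarrow> int"
  assumes il: "interlace k b l"
begin

text \<open>A blocked move means \<open>b (j - 1) = l j\<close>, and the numerator factor with
  \<open>i = j - 1\<close> becomes \<open>1 - q powi 0 * t ^ 0\<close>.\<close>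

lemma S_prod_outside_F:
  assumes "j \<in> {1..k}" "j \<notin> F k b l"
  shows "S_prod q t k b l j = 0"
proof -
  have j: "j - 1 \<in> {1..<j}" "b (j - 1) \<le> l j" using assms by (auto simp: F_def)
  then have "b (j - 1) = l j"
    using interlace_lower[OF il, of "j - 1" j] assms by auto
  then have "\<exists>i\<in>{1..<j}. 1 - q powi (b i - l j) * t ^ (j - i - 1) = 0"
    using j by (intro bexI[of _ "j - 1"]) auto
  then show ?thesis by (auto simp: S_prod_def)
qed

lemma T_prod_outside_F:
  assumes "j \<in> {1..<k}" "j + 1 \<notin> F k b l"
  shows "T_prod q t k b l j = 0"
proof -
  have "b j \<le> l (j + 1)" using assms by (auto simp: F_def)
  then have "b j = l (j + 1)"
    using interlace_lower[OF il, of j "j + 1"] assms by auto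
  then have "\<exists>n\<in>{j..<k}. 1 - q powi (b j - l (n + 1)) * t ^ (n - j) = 0"
    using assms by (intro bexI[of _ j]) auto
  then show ?thesis by (auto simp: T_prod_def)
qed

text \<open>For \<open>j\<close> in \<open>F\<close> all exponents are nonnegative and the
  denominators do not vanish in the limit. For a blocked \<open>j\<close> the exponent
  \<open>b (j - 1) - l j - 1\<close> is -1, so limits are taken only in sums restricted to
  \<open>F\<close>.\<close>

lemma tendsto_S_prod:
  assumes q: "0 \<le> q" "q < 1" and t: "0 \<le> t" "t < 1" and j: "j \<in> F k b l"
    and g: "(g \<longlongrightarrow> q) G" and h: "(h \<longlongrightarrow> t) G"
  shows "((\<lambda>s. S_prod (g s) (h s) k b l j) \<longlongrightarrow> S_prod q t k b l j) G"
proof -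
  have jk: "1 \<le> j" "j \<le> k" using j by (auto simp: F_def)
  have GT: "b \<in> GT (k - 1)" "l \<in> GT k" using il by (auto simp: interlace_def)
  have up: "l i - l j \<ge> 1 \<and> b i - l j \<ge> 1" if i: "i \<in> {1..<j}" for i
  proof -
    have "b (j - 1) \<le> b i" "l j < b (j - 1)"
      using antimono_GT[OF GT(1), of i "j - 1"] i j jk by (auto simp: F_def)
    then show ?thesis using interlace_upper[OF il, of i i] i jk by auto
  qed
  have down: "l j - l (n + 1) \<ge> 0 \<and> l j - b n \<ge> 0" if n: "n \<in> {j..<k}" for n
    using antimono_GT[OF GT(2), of j "n + 1"] interlace_upper[OF il, of j n] n jk by auto
  show ?thesis
    unfolding S_prod_def
    by (intro tendsto_mult tendsto_prod tendsto_divide tendsto_diff tendsto_const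
        tendsto_monomial[OF g h] monomial_neq_1[OF q t]; (frule up | frule down); auto)
qed

lemma tendsto_T_prod:
  assumes q: "0 \<le> q" "q < 1" and t: "0 \<le> t" "t < 1" and j: "j + 1 \<in> F k b l" "1 \<le> j"
    and g: "(g \<longlongrightarrow> q) G" and h: "(h \<longlongrightarrow> t) G"
  shows "((\<lambda>s. T_prod (g s) (h s) k b l j) \<longlongrightarrow> T_prod q t k b l j) G"
proof -
  have jk: "1 \<le> j" "j < k" and jF: "l (j + 1) < b j" using j by (auto simp: F_def)
  have GT: "b \<in> GT (k - 1)" "l \<in> GT k" using il by (auto simp: interlace_def)
  \<comment> \<open>The strict bound comes from the chain
    \<open>b n \<le> l n \<le> l (j + 1) < b j\<close>.\<close>
  have 1: "b j - b n \<ge> 1" if n: "n \<in> {j<..<k}" for n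
    using antimono_GT[OF GT(2), of "j + 1" n] interlace_upper[OF il, of n n] n jk jF by auto
  have 2: "b j - l (n + 1) \<ge> 1" if n: "n \<in> {j..<k}" for n
    using antimono_GT[OF GT(2), of "j + 1" "n + 1"] n jk jF by auto
  have 3: "b i - b j \<ge> 0" if i: "i \<in> {1..<j}" for i
    using antimono_GT[OF GT(1), of i j] i jk by auto
  have 4: "l i - b j \<ge> 0" if i: "i \<in> {1..j}" for i
    using interlace_upper[OF il, of i j] i jk by auto
  show ?thesis
    unfolding T_prod_def
    by (intro tendsto_mult tendsto_prod tendsto_divide tendsto_diff tendsto_const
        tendsto_monomial[OF g h] monomial_neq_1[OF q t]; (frule 1 | frule 2 | frule 3 | frule 4); auto)
qed

text \<open>The filter is left open because the sum rule is extended in two stages, by a limit in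
  \<open>t\<close> and then by one in \<open>q\<close>.\<close>

lemma sum_S_prod_limit:
  assumes q: "0 \<le> q" "q < 1" and t: "0 \<le> t" "t < 1" and "G \<noteq> bot"
    and g: "(g \<longlongrightarrow> q) G" and h: "(h \<longlongrightarrow> t) G"
    and ev: "eventually (\<lambda>s. (\<Sum>j\<in>F k b l. S_prod (g s) (h s) k b l j) =
      1 + (\<Sum>j | j \<in> {1..<k} \<and> j + 1 \<in> F k b l. T_prod (g s) (h s) k b l j)) G"
  shows "(\<Sum>j\<in>F k b l. S_prod q t k b l j) = 1 + (\<Sum>j | j \<in> {1..<k} \<and> j + 1 \<in> F k b l. T_prod q t k b l j)"
proof (rule tendsto_unique[OF \<open>G \<noteq> bot\<close>])
  show "((\<lambda>s. \<Sum>j\<in>F k b l. S_prod (g s) (h s) k b l j) \<longlongrightarrow> (\<Sum>j\<in>F k b l. S_prod q t k b l j)) G"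
    by (intro tendsto_sum tendsto_S_prod q t g h)
  have "((\<lambda>s. 1 + (\<Sum>j | j \<in> {1..<k} \<and> j + 1 \<in> F k b l. T_prod (g s) (h s) k b l j)) \<longlongrightarrow>
      1 + (\<Sum>j | j \<in> {1..<k} \<and> j + 1 \<in> F k b l. T_prod q t k b l j)) G"
    by (intro tendsto_add tendsto_const tendsto_sum tendsto_T_prod q t g h) auto
  then show "((\<lambda>s. \<Sum>j\<in>F k b l. S_prod (g s) (h s) k b l j) \<longlongrightarrow>
      1 + (\<Sum>j | j \<in> {1..<k} \<and> j + 1 \<in> F k b l. T_prod q t k b l j)) G"
    by (rule Lim_transform_eventually) (use ev in eventually_elim, simp)
qed

text \<open>First \<open>q > 0\<close> is fixed and \<open>t\<close> is approached from the right
  through generic values; then \<open>q = 0\<close> is reached from positive \<open>q\<close> with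
  \<open>t\<close> fixed. Limits from the right keep the perturbed parameter in the open unit
  interval.\<close>

lemma sum_S_prod:
  assumes k: "k \<ge> 1" and q: "0 \<le> q" "q < 1" and t: "0 \<le> t" "t < 1"
  shows "(\<Sum>j\<in>F k b l. S_prod q t k b l j) = 1 + (\<Sum>j | j \<in> {1..<k} \<and> j + 1 \<in> F k b l. T_prod q t k b l j)"
    (is "?P q t")
proof -
  have generic: "?P q t" if "0 < q" "q < 1" "0 < t" "t < 1" "\<And>m. m \<in> {1..k} \<Longrightarrow> t ^ m \<noteq> q" for q t
  proof -
    have "(\<Sum>j\<in>F k b l. S_prod q t k b l j) = (\<Sum>j\<in>{1..k}. S_prod q t k b l j)"
      using S_prod_outside_F by (intro sum.mono_neutral_left) (auto simp: F_def)
    moreover have "(\<Sum>j | j \<in> {1..<k} \<and> j + 1 \<in> F k b l. T_prod q t k b l j) = (\<Sum>j\<in>{1..<k}. T_prod q t k b l j)"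
      using T_prod_outside_F by (intro sum.mono_neutral_left) auto
    ultimately show ?thesis using sum_S_prod_generic[OF il k that] by simp
  qed
  have positive: "?P q t" if q: "0 < q" "q < 1" and t: "0 \<le> t" "t < 1" for q t
  proof (rule sum_S_prod_limit[where g = "\<lambda>_. q" and h = "\<lambda>s. s" and G = "at_right t"])
    \<comment> \<open>The excluded values of \<open>t\<close> are the roots of \<open>q\<close> of
      order at most \<open>k\<close>, hence finitely many.\<close>
    have "finite {s :: real. s > 0 \<and> (\<exists>m\<in>{1..k}. s ^ m = q)}"
    proof (rule finite_subset)
      show "{s :: real. s > 0 \<and> (\<exists>m\<in>{1..k}. s ^ m = q)} \<subseteq> (\<lambda>m. root m q) ` {1..k}"
      proof
        fix s assume "s \<in> {s :: real. s > 0 \<and> (\<exists>m\<in>{1..k}. s ^ m = q)}"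
        then obtain m where m: "s > 0" "m \<in> {1..k}" "s ^ m = q" by blast
        then have "s = root m q" using real_root_power_cancel[of m s] by auto
        then show "s \<in> (\<lambda>m. root m q) ` {1..k}" using m by blast
      qed
    qed simp
    then have "eventually (\<lambda>s. \<forall>y\<in>{s. s > 0 \<and> (\<exists>m\<in>{1..k}. s ^ m = q)} - {t}. s \<noteq> y) (at_right t)"
      by (intro eventually_ball_finite ballI tendsto_imp_eventually_ne[OF tendsto_ident_at]) auto
    moreover have "eventually (\<lambda>s. t < s \<and> s < 1) (at_right t)"
      using t eventually_at_right_field by blast
    ultimately show "eventually (\<lambda>s. ?P q s) (at_right t)"
    proof eventually_elim
      case (elim s)
      have "s ^ m \<noteq> q" if "m \<in> {1..k}" for m
      proof
        assume "s ^ m = q"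
        then have "s \<in> {s. s > 0 \<and> (\<exists>m\<in>{1..k}. s ^ m = q)} - {t}" using that elim t by auto
        then show False using elim(1) by blast
      qed
      then show ?case using generic q t elim by auto
    qed
  qed (use q t in auto)
  show ?thesis
  proof (cases "q = 0")
    case True
    show ?thesis
    proof (rule sum_S_prod_limit[where g = "\<lambda>s. s" and h = "\<lambda>_. t" and G = "at_right q"])
      have "eventually (\<lambda>s. 0 < s \<and> s < 1) (at_right q)"
        using q True eventually_at_right_field by blast
      then show "eventually (\<lambda>s. ?P s t) (at_right q)"
        by eventually_elim (rule positive; use t in auto)
    qed (use q t in auto)
  qed (use positive q t in auto)
qed

end

section \<open>The skew Pieri rule\<close>

lemma psi_eq_0: "\<not> interlace k b l \<Longrightarrow> psi q t k l b = 0"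
  by (simp add: psi_def)

lemma psi'_eq_0: "l + e j \<notin> GT k \<Longrightarrow> psi' q t k l j = 0" "l \<notin> GT k \<Longrightarrow> psi' q t k l j = 0"
  by (simp_all add: psi'_def)

text \<open>If moving one coordinate at \<open>j\<close> restores interlacing, the only violated
  inequality is \<open>b j \<le> l j\<close>, and it fails by exactly 1. Raising \<open>l j\<close>
  and lowering \<open>b j\<close> both repair it.\<close>

lemma forced_iff:
  assumes b: "b \<in> GT (k - 1)" and l: "l \<in> GT k" and not: "\<not> interlace k b l" and j: "j \<in> {1..<k}"
  shows "interlace k b (l + e j) \<longleftrightarrow> interlace k (b - e j) l"
    and "interlace k b (l + e j) \<Longrightarrow> b j = l j + 1"
proof -
  have bnd: "l (i + 1) \<le> b i \<and> b i \<le> (l + e j) i" if "interlace k b (l + e j)" "i \<in> {1..k - 1}" for i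
  proof -
    have "(l + e j) (i + 1) \<le> b i \<and> b i \<le> (l + e j) i" using that by (simp add: interlace_def)
    then show ?thesis by (auto simp: e_def split: if_splits)
  qed
  show eq: "b j = l j + 1" if "interlace k b (l + e j)"
  proof -
    obtain i where i: "i \<in> {1..k - 1}" "\<not> (l (i + 1) \<le> b i \<and> b i \<le> l i)"
      using not b l by (auto simp: interlace_def)
    then have "i = j" "l j < b j" using bnd[OF that i(1)] by (auto simp: e_def split: if_splits)
    then show ?thesis using bnd[OF that i(1)] by (auto simp: e_def)
  qed
  show "interlace k b (l + e j) \<longleftrightarrow> interlace k (b - e j) l"
  proof
    assume *: "interlace k b (l + e j)"
    have bj: "b j = l j + 1" by (rule eq[OF *])
    have 1: "l (i + 1) \<le> (b - e j) i \<and> (b - e j) i \<le> l i" if i: "i \<in> {1..k - 1}" for i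
    proof (cases "i = j")
      case True
      have "l (j + 1) \<le> l j" using l j by (auto simp: GT_def)
      then show ?thesis using True bj by (simp add: e_def)
    next
      case False
      then show ?thesis using bnd[OF * i] by (simp add: e_def)
    qed
    have "(b - e j) (i + 1) \<le> (b - e j) i" if "i \<in> {1..<k - 1}" for i
      using 1[of i] 1[of "i + 1"] that by force
    moreover have "(b - e j) i = 0" if "i \<notin> {1..k - 1}" for i
      using b that j by (auto simp: GT_def e_def)
    ultimately show "interlace k (b - e j) l" using l 1 by (auto simp: interlace_def GT_def)
  next
    assume *: "interlace k (b - e j) l"
    have bnd': "l (i + 1) \<le> (b - e j) i \<and> (b - e j) i \<le> l i" if "i \<in> {1..k - 1}" for i
      using * that by (simp add: interlace_def)
    obtain i where i: "i \<in> {1..k - 1}" "\<not> (l (i + 1) \<le> b i \<and> b i \<le> l i)"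
      using not b l by (auto simp: interlace_def)
    then have bj: "b j = l j + 1" using bnd'[OF i(1)] by (auto simp: e_def split: if_splits)
    have 1: "(l + e j) (i + 1) \<le> b i \<and> b i \<le> (l + e j) i" if i: "i \<in> {1..k - 1}" for i
    proof -
      have "i + 1 = j \<Longrightarrow> b j \<le> b i" using b i j by (auto simp: GT_def)
      then show ?thesis using bnd'[OF i] bj by (auto simp: e_def split: if_splits)
    qed
    have "(l + e j) (i + 1) \<le> (l + e j) i" if "i \<in> {1..<k}" for i
      using 1[of i] that by force
    moreover have "(l + e j) i = 0" if "i \<notin> {1..k}" for i
      using l that j by (auto simp: GT_def e_def)
    ultimately show "interlace k b (l + e j)" using b 1 by (auto simp: interlace_def GT_def)
  qed
qed

text \<open>The coordinate \<open>l k\<close> is bounded only from above by \<open>b\<close>, so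
  raising it cannot repair a violated inequality.\<close>

lemma not_interlace_add_last:
  assumes "b \<in> GT (k - 1)" "l \<in> GT k" "\<not> interlace k b l"
  shows "\<not> interlace k b (l + e k)"
proof
  assume *: "interlace k b (l + e k)"
  have "l (i + 1) \<le> b i \<and> b i \<le> l i" if "i \<in> {1..k - 1}" for i
  proof -
    have "(l + e k) (i + 1) \<le> b i \<and> b i \<le> (l + e k) i" using * that by (simp add: interlace_def)
    then show ?thesis using that by (auto simp: e_def split: if_splits)
  qed
  then show False using assms by (auto simp: interlace_def)
qed

context
  fixes q t :: real
  assumes q: "0 \<le> q" "q < 1" and t: "0 \<le> t" "t < 1"
begin

text \<open>Here \<open>b\<close> is the lower signature after the move, as in the dynamics
  equation. If the move is not forced, both sides are 0 by \<open>forced_iff\<close>.\<close>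

lemma psi_forced_move_at_target:
  assumes b: "b \<in> GT (k - 1)" and l: "l \<in> GT k" and not: "\<not> interlace k b l" and j: "j \<in> {1..<k}"
  shows "psi' q t k l j * psi q t k (l + e j) b = psi q t k l (b - e j) * psi' q t (k - 1) (b - e j) j"
proof (cases "interlace k b (l + e j)")
  case True
  then have il: "interlace k (b - e j) l" "b j = l j + 1" using forced_iff[OF assms] by auto
  have "interlace k (b - e j + e j) (l + e j)" using True by simp
  from psi_forced_move[OF q t il(1) this j] il(2) show ?thesis
    by (simp add: e_def[of j, THEN fun_cong, of j] mult.commute)
next
  case False
  then show ?thesis using forced_iff(1)[OF assms] by (simp add: psi_eq_0)
qed

lemma sum_S:
  assumes il: "interlace k b l" and k: "k \<ge> 1"
  shows "(\<Sum>j\<in>F k b l. S q t k b l j) = 1 + (\<Sum>j | j \<in> {1..<k} \<and> j + 1 \<in> F k b l. T q t k b l j)"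
proof -
  have "(\<Sum>j\<in>F k b l. S q t k b l j) = (\<Sum>j\<in>F k b l. S_prod q t k b l j)"
  proof (rule sum.cong[OF refl])
    fix j assume j: "j \<in> F k b l"
    then have "j \<in> {1..k}" by (simp add: F_def)
    then show "S q t k b l j = S_prod q t k b l j"
      using S_eq_S_prod[OF q t il] interlace_add_iff[OF il] j by blast
  qed
  moreover have "(\<Sum>j | j \<in> {1..<k} \<and> j + 1 \<in> F k b l. T q t k b l j) =
      (\<Sum>j | j \<in> {1..<k} \<and> j + 1 \<in> F k b l. T_prod q t k b l j)"
    using T_eq_T_prod[OF q t il] interlace_diff_iff[OF il] by (intro sum.cong) blast+
  ultimately show ?thesis using sum_S_prod[OF il k q t] by simp
qed

text \<open>For interlacing \<open>b\<close> and \<open>l\<close> this is \<open>sum_S\<close> times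
  \<open>psi\<close>. Otherwise \<open>psi q t k l b\<close> is 0, the summand \<open>j = k\<close>
  vanishes, and the two sums agree term by term through forced moves.\<close>

lemma skew_Pieri:
  assumes b: "b \<in> GT (k - 1)" and l: "l \<in> GT k" and k: "k \<ge> 1"
  shows "(\<Sum>j\<in>{1..k}. psi' q t k l j * psi q t k (l + e j) b) =
    psi q t k l b + (\<Sum>j\<in>{1..<k}. psi q t k l (b - e j) * psi' q t (k - 1) (b - e j) j)"
proof (cases "interlace k b l")
  case il: True
  have nz: "psi q t k l b \<noteq> 0" using psi_pos[OF q t il] by simp
  have "(\<Sum>j\<in>{1..k}. psi' q t k l j * psi q t k (l + e j) b) = (\<Sum>j\<in>F k b l. psi' q t k l j * psi q t k (l + e j) b)"
    using interlace_add_iff[OF il] by (intro sum.mono_neutral_right) (auto simp: F_def psi_eq_0)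
  also have "\<dots> = psi q t k l b * (\<Sum>j\<in>F k b l. S q t k b l j)"
    unfolding sum_distrib_left using nz by (intro sum.cong) (auto simp: S_def)
  also have "\<dots> = psi q t k l b + psi q t k l b * (\<Sum>j | j \<in> {1..<k} \<and> j + 1 \<in> F k b l. T q t k b l j)"
    unfolding sum_S[OF il k] by (simp add: distrib_left)
  also have "psi q t k l b * (\<Sum>j | j \<in> {1..<k} \<and> j + 1 \<in> F k b l. T q t k b l j) =
      (\<Sum>j | j \<in> {1..<k} \<and> j + 1 \<in> F k b l. psi q t k l (b - e j) * psi' q t (k - 1) (b - e j) j)"
    unfolding sum_distrib_left using nz by (intro sum.cong) (auto simp: T_def)
  also have "\<dots> = (\<Sum>j\<in>{1..<k}. psi q t k l (b - e j) * psi' q t (k - 1) (b - e j) j)"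
    using interlace_diff_iff[OF il] by (intro sum.mono_neutral_left) (auto simp: psi_eq_0)
  finally show ?thesis .
next
  case False
  have "{1..k} = insert k {1..<k}" using k by auto
  then have "(\<Sum>j\<in>{1..k}. psi' q t k l j * psi q t k (l + e j) b) = (\<Sum>j\<in>{1..<k}. psi' q t k l j * psi q t k (l + e j) b)"
    using not_interlace_add_last[OF b l False] by (simp add: psi_eq_0)
  then show ?thesis using psi_forced_move_at_target[OF b l False] False by (simp add: psi_eq_0)
qed

end

section \<open>Branching, positivity and the Pieri rule for \<open>P\<close>\<close>

lemma finite_interlace: "finite {b. interlace k b l}"
proof (rule finite_subset)
  let ?B = "{b. \<forall>i. (i \<in> {1..k - 1} \<longrightarrow> b i \<in> {l k..l 1}) \<and> (i \<notin> {1..k - 1} \<longrightarrow> b i = (0::int))}"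
  show "finite ?B" by (intro finite_set_of_finite_funs) auto
  show "{b. interlace k b l} \<subseteq> ?B"
  proof (intro subsetI CollectI allI conjI impI)
    fix b i assume b: "b \<in> {b. interlace k b l}" and i: "i \<in> {1..k - 1}"
    then have "l k \<le> b i" "b i \<le> l 1"
      using interlace_lower[of k b l i k] interlace_upper[of k b l 1 i] by auto
    then show "b i \<in> {l k..l 1}" by simp
  qed (auto simp: interlace_def GT_def)
qed

lemma GT_0: "GT 0 = {0}"
  by (auto simp: GT_def)

lemma P_0: "P q t a 0 0 = 1"
proof -
  have "GT_patterns 0 0 = {\<lambda>i\<in>{0}. 0}"
    by (auto simp: GT_patterns_def GT_0 PiE_iff extensional_def restrict_def fun_eq_iff)
  then show ?thesis by (simp add: P_def)
qed

lemma GT_patterns_Suc: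
  "GT_patterns (Suc k) l = (\<Union>b\<in>{b. interlace (Suc k) b l}. (\<lambda>L. L(Suc k := l)) ` GT_patterns k b)"
proof (intro equalityI subsetI)
  fix L assume L: "L \<in> GT_patterns (Suc k) l"
  then have il: "interlace (Suc k) (L k) l" by (force simp: GT_patterns_def)
  \<comment> \<open>Removing the top row means resetting it to \<open>undefined\<close>, the value
    of an extensional function outside its domain.\<close>
  have "L(Suc k := undefined) \<in> GT_patterns k (L k)"
    using L by (auto simp: GT_patterns_def PiE_iff extensional_def)
  moreover have "L = (L(Suc k := undefined))(Suc k := l)"
    using L by (auto simp: GT_patterns_def)
  ultimately show "L \<in> (\<Union>b\<in>{b. interlace (Suc k) b l}. (\<lambda>L. L(Suc k := l)) ` GT_patterns k b)"
    using il by blast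
next
  fix L assume "L \<in> (\<Union>b\<in>{b. interlace (Suc k) b l}. (\<lambda>L. L(Suc k := l)) ` GT_patterns k b)"
  then obtain M where M: "interlace (Suc k) (M k) l" "M \<in> GT_patterns k (M k)" "L = M(Suc k := l)"
    by (auto simp: GT_patterns_def)
  then have "l \<in> GT (Suc k)" by (simp add: interlace_def)
  then show "L \<in> GT_patterns (Suc k) l"
    using M by (auto simp: GT_patterns_def PiE_iff extensional_def le_Suc_eq)
qed

text \<open>The branching rule. Any finite \<open>B\<close> containing the interlacing signatures
  may serve as index set, because \<open>psi\<close> vanishes on the others; sums for different
  \<open>l\<close> can thus share one index set and be interchanged.\<close>

lemma P_Suc:
  assumes "finite B" "{b. interlace (Suc k) b l} \<subseteq> B"
  shows "P q t a (Suc k) l =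
    (\<Sum>b\<in>B. P q t a k b * (psi q t (Suc k) l b * a (Suc k) powi (weight (Suc k) l - weight k b)))"
proof -
  let ?w = "\<lambda>L i. psi q t i (L i) (L (i - 1)) * a i powi (weight i (L i) - weight (i - 1) (L (i - 1)))"
  let ?u = "\<lambda>L. L(Suc k := l)"
  let ?g = "\<lambda>b. P q t a k b * (psi q t (Suc k) l b * a (Suc k) powi (weight (Suc k) l - weight k b))"
  have "P q t a (Suc k) l = (\<Sum>b | interlace (Suc k) b l. \<Sum>L\<in>?u ` GT_patterns k b. \<Prod>i=1..Suc k. ?w L i)"
    unfolding P_def GT_patterns_Suc
  proof (rule sum.UNION_disjoint)
    show "\<forall>b\<in>{b. interlace (Suc k) b l}. \<forall>b'\<in>{b. interlace (Suc k) b l}. b \<noteq> b' \<longrightarrow>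
        ?u ` GT_patterns k b \<inter> ?u ` GT_patterns k b' = {}"
    proof (intro ballI impI equals0I)
      fix b b' L assume "b \<noteq> b'" "L \<in> ?u ` GT_patterns k b \<inter> ?u ` GT_patterns k b'"
      moreover have "L k = c" if "L \<in> ?u ` GT_patterns k c" for c
        using that by (auto simp: GT_patterns_def)
      ultimately have "L k = b" "L k = b'" by blast+
      with \<open>b \<noteq> b'\<close> show False by simp
    qed
  qed (auto simp: finite_interlace finite_GT_patterns)
  also have "\<dots> = (\<Sum>b | interlace (Suc k) b l. ?g b)"
  proof (rule sum.cong[OF refl])
    fix b
    have inj: "inj_on ?u (GT_patterns k b)"
    proof (rule inj_onI)
      fix L M assume LM: "L \<in> GT_patterns k b" "M \<in> GT_patterns k b" "?u L = ?u M"
      show "L = M"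
      proof
        fix i show "L i = M i"
        proof (cases "i = Suc k")
          case True
          then show ?thesis using LM(1,2) by (auto simp: GT_patterns_def PiE_iff extensional_def)
        next
          case False
          then show ?thesis using fun_cong[OF LM(3), of i] by simp
        qed
      qed
    qed
    have "(\<Sum>L\<in>?u ` GT_patterns k b. \<Prod>i=1..Suc k. ?w L i) = (\<Sum>L\<in>GT_patterns k b. \<Prod>i=1..Suc k. ?w (?u L) i)"
      by (subst sum.reindex[OF inj]) simp
    also have "\<dots> = (\<Sum>L\<in>GT_patterns k b. (\<Prod>i=1..k. ?w L i) *
        (psi q t (Suc k) l b * a (Suc k) powi (weight (Suc k) l - weight k b)))"
    proof (rule sum.cong[OF refl])
      fix L assume "L \<in> GT_patterns k b"
      then have "L k = b" by (simp add: GT_patterns_def)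
      moreover have "(\<Prod>i=1..k. ?w (?u L) i) = (\<Prod>i=1..k. ?w L i)"
        by (rule prod.cong) auto
      ultimately show "(\<Prod>i=1..Suc k. ?w (?u L) i) = (\<Prod>i=1..k. ?w L i) *
          (psi q t (Suc k) l b * a (Suc k) powi (weight (Suc k) l - weight k b))"
        by simp
    qed
    finally show "(\<Sum>L\<in>?u ` GT_patterns k b. \<Prod>i=1..Suc k. ?w L i) = ?g b"
      by (simp add: P_def sum_distrib_right)
  qed
  also have "\<dots> = (\<Sum>b\<in>B. ?g b)"
    using assms by (intro sum.mono_neutral_left) (auto simp: psi_eq_0)
  finally show ?thesis .
qed

text \<open>Truncation provides a signature below \<open>l\<close>, so the branching sum for
  \<open>P\<close> is not empty and positivity passes to the next level.\<close>

lemma interlace_restrict: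
  assumes "l \<in> GT (Suc k)"
  shows "interlace (Suc k) (\<lambda>i. if i \<le> k then l i else 0) l"
  using assms by (auto simp: interlace_def GT_def)

lemma weight_add_e: "j \<in> {1..k} \<Longrightarrow> weight k (l + e j) = weight k l + 1"
  by (simp add: weight_def e_def sum.distrib)

context
  fixes q t :: real and a :: "nat \<Rightarrow> real"
  assumes q: "0 \<le> q" "q < 1" and t: "0 \<le> t" "t < 1"
begin

lemma P_pos:
  assumes "l \<in> GT k" "\<And>i. i \<in> {1..k} \<Longrightarrow> a i > 0"
  shows "P q t a k l > 0"
  using assms
proof (induction k arbitrary: l)
  case (Suc k)
  have "P q t a (Suc k) l = (\<Sum>b | interlace (Suc k) b l.
      P q t a k b * (psi q t (Suc k) l b * a (Suc k) powi (weight (Suc k) l - weight k b)))"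
    by (rule P_Suc) (auto simp: finite_interlace)
  also have "\<dots> > 0"
  proof (rule sum_pos)
    show "{b. interlace (Suc k) b l} \<noteq> {}" using interlace_restrict[OF Suc.prems(1)] by auto
    fix b assume "b \<in> {b. interlace (Suc k) b l}"
    moreover from this have "b \<in> GT k" by (simp add: interlace_def)
    ultimately show "P q t a k b * (psi q t (Suc k) l b * a (Suc k) powi (weight (Suc k) l - weight k b)) > 0"
      using Suc psi_pos[OF q t, of "Suc k" b l] by (intro mult_pos_pos zero_less_power_int) auto
  qed (rule finite_interlace)
  finally show ?case .
qed (simp add: GT_0 P_0)

text \<open>Branching expands \<open>P\<close> at \<open>l + e j\<close>, and
  \<open>skew_Pieri\<close> transfers the jump from the top level to the level below. The unmoved
  term contributes the new variable \<open>x\<close>; the moved terms are sums of the same type one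
  level down and yield the remaining variables by induction.\<close>

lemma Pieri:
  assumes "l \<in> GT k" "\<And>i. i \<in> {1..k} \<Longrightarrow> a i > 0"
  shows "(\<Sum>j\<in>{1..k}. P q t a k (l + e j) * psi' q t k l j) = (\<Sum>i\<in>{1..k}. a i) * P q t a k l"
  using assms
proof (induction k arbitrary: l)
  case (Suc k)
  let ?K = "Suc k"
  define x where "x = a ?K"
  have x: "x > 0" using Suc.prems by (simp add: x_def)
  define C where "C = {b. interlace ?K b l}"
  \<comment> \<open>One finite set containing every \<open>b\<close> below some
    \<open>l + e j\<close> or below \<open>l\<close>, and every shift of the latter that is a
    signature.\<close>
  define B where "B = ((\<Union>j\<in>{1..?K}. {b. interlace ?K b (l + e j)}) \<union> C \<union> (\<Union>j\<in>{1..k}. (\<lambda>b. b + e j) ` C)) \<inter> GT k"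
  have fin: "finite C" "finite B" by (auto simp: B_def C_def finite_interlace)
  have sub: "{b. interlace ?K b (l + e j)} \<subseteq> B" if "j \<in> {1..?K}" for j
    using that unfolding B_def by (auto simp: interlace_def)
  have C_sub: "{b. interlace ?K b l} \<subseteq> C" by (simp add: C_def)
  have subC: "C \<subseteq> B" by (auto simp: B_def C_def interlace_def)
  have "(\<Sum>j\<in>{1..?K}. P q t a ?K (l + e j) * psi' q t ?K l j) =
      (\<Sum>j\<in>{1..?K}. \<Sum>b\<in>B. P q t a k b * x powi (weight ?K l + 1 - weight k b) * (psi' q t ?K l j * psi q t ?K (l + e j) b))"
  proof (rule sum.cong[OF refl])
    fix j assume j: "j \<in> {1..?K}"
    show "P q t a ?K (l + e j) * psi' q t ?K l j =
        (\<Sum>b\<in>B. P q t a k b * x powi (weight ?K l + 1 - weight k b) * (psi' q t ?K l j * psi q t ?K (l + e j) b))"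
      unfolding P_Suc[OF fin(2) sub[OF j]] weight_add_e[OF j] x_def sum_distrib_right
      by (simp only: mult_ac)
  qed
  also have "\<dots> = (\<Sum>b\<in>B. P q t a k b * x powi (weight ?K l + 1 - weight k b) *
      (\<Sum>j\<in>{1..?K}. psi' q t ?K l j * psi q t ?K (l + e j) b))"
    unfolding sum_distrib_left by (rule sum.swap)
  also have "\<dots> = (\<Sum>b\<in>B. P q t a k b * x powi (weight ?K l + 1 - weight k b) *
      (psi q t ?K l b + (\<Sum>j\<in>{1..k}. psi q t ?K l (b - e j) * psi' q t k (b - e j) j)))"
  proof (rule sum.cong[OF refl])
    fix b assume "b \<in> B"
    then have "b \<in> GT (?K - 1)" by (simp add: B_def)
    from skew_Pieri[OF q t this Suc.prems(1)]
    show "P q t a k b * x powi (weight ?K l + 1 - weight k b) * (\<Sum>j\<in>{1..?K}. psi' q t ?K l j * psi q t ?K (l + e j) b) =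
      P q t a k b * x powi (weight ?K l + 1 - weight k b) *
      (psi q t ?K l b + (\<Sum>j\<in>{1..k}. psi q t ?K l (b - e j) * psi' q t k (b - e j) j))"
      by (simp add: atLeastLessThanSuc_atLeastAtMost)
  qed
  also have "\<dots> = x * P q t a ?K l +
      (\<Sum>j\<in>{1..k}. \<Sum>b\<in>B. P q t a k b * x powi (weight ?K l + 1 - weight k b) * (psi q t ?K l (b - e j) * psi' q t k (b - e j) j))"
  proof -
    have "x powi (weight ?K l + 1 - weight k b) = x * x powi (weight ?K l - weight k b)" for b
      using power_int_add_1'[of x "weight ?K l - weight k b"] x by (simp add: algebra_simps)
    then have "(\<Sum>b\<in>B. P q t a k b * x powi (weight ?K l + 1 - weight k b) * psi q t ?K l b) = x * P q t a ?K l"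
      unfolding P_Suc[OF fin(2) subC[unfolded C_def]] sum_distrib_left by (simp add: x_def mult_ac)
    then show ?thesis
      unfolding distrib_left sum.distrib sum_distrib_left by (subst (2) sum.swap) simp
  qed
  also have "(\<Sum>j\<in>{1..k}. \<Sum>b\<in>B. P q t a k b * x powi (weight ?K l + 1 - weight k b) * (psi q t ?K l (b - e j) * psi' q t k (b - e j) j)) =
      (\<Sum>j\<in>{1..k}. \<Sum>b\<in>C. psi q t ?K l b * x powi (weight ?K l - weight k b) * (P q t a k (b + e j) * psi' q t k b j))"
  proof (rule sum.cong[OF refl])
    fix j assume j: "j \<in> {1..k}"
    let ?h = "\<lambda>b. P q t a k b * x powi (weight ?K l + 1 - weight k b) * (psi q t ?K l (b - e j) * psi' q t k (b - e j) j)"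
    \<comment> \<open>The substitution of \<open>b + e j\<close> for \<open>b\<close> raises the
      weight by 1, which absorbs the extra power of \<open>x\<close>. Shifts outside
      \<open>B\<close> are not signatures, so \<open>psi'\<close> removes them.\<close>
    have "(\<Sum>b\<in>B. ?h b) = (\<Sum>b\<in>(\<lambda>b. b + e j) ` C. ?h b)"
    proof (rule sum.mono_neutral_cong)
      show "?h b = 0" if "b \<in> B - (\<lambda>b. b + e j) ` C" for b
      proof -
        have "b - e j \<notin> C" using that by (metis DiffD2 diff_add_cancel image_eqI)
        then show ?thesis by (simp add: C_def psi_eq_0)
      qed
      show "?h b = 0" if "b \<in> (\<lambda>b. b + e j) ` C - B" for b
      proof -
        have "b \<notin> GT k" using that j unfolding B_def by blast
        then show ?thesis by (simp add: psi'_eq_0)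
      qed
    qed (use fin in auto)
    also have "\<dots> = (\<Sum>b\<in>C. ?h (b + e j))"
      by (subst sum.reindex) (auto simp: inj_on_def)
    also have "\<dots> = (\<Sum>b\<in>C. psi q t ?K l b * x powi (weight ?K l - weight k b) * (P q t a k (b + e j) * psi' q t k b j))"
      by (rule sum.cong) (simp_all add: weight_add_e[OF j])
    finally show "(\<Sum>b\<in>B. ?h b) = \<dots>" .
  qed
  also have "\<dots> = (\<Sum>b\<in>C. psi q t ?K l b * x powi (weight ?K l - weight k b) * (\<Sum>j\<in>{1..k}. P q t a k (b + e j) * psi' q t k b j))"
    unfolding sum_distrib_left by (rule sum.swap)
  also have "\<dots> = (\<Sum>b\<in>C. psi q t ?K l b * x powi (weight ?K l - weight k b) * ((\<Sum>i\<in>{1..k}. a i) * P q t a k b))"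
    using Suc by (intro sum.cong arg_cong2[where f = "(*)"] refl Suc.IH) (auto simp: C_def interlace_def)
  also have "\<dots> = (\<Sum>i\<in>{1..k}. a i) * P q t a ?K l"
    unfolding P_Suc[OF fin(1) C_sub] sum_distrib_left
    by (simp add: x_def mult_ac)
  finally show ?case by (simp add: x_def distrib_right)
qed simp

end

section \<open>Finite sums over moves and the linear system without enumeration\<close>

text \<open>Turns sums over all signatures into finite sums over moves \<open>j\<close>; the
  condition \<open>p j \<in> A\<close> discards moves that leave the set of signatures.\<close>

lemma infsum_finite_support:
  fixes g :: "'a \<Rightarrow> real"
  assumes "finite J" "inj_on p J" "\<And>n. n \<in> A \<Longrightarrow> n \<notin> p ` J \<Longrightarrow> g n = 0"
  shows "(\<Sum>\<^sub>\<infinity>n\<in>A. g n) = (\<Sum>j | j \<in> J \<and> p j \<in> A. g (p j))"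
proof -
  let ?J = "{j \<in> J. p j \<in> A}"
  have "(\<Sum>\<^sub>\<infinity>n\<in>A. g n) = (\<Sum>\<^sub>\<infinity>n\<in>p ` ?J. g n)"
    using assms(3) by (intro infsum_cong_neutral) auto
  also have "\<dots> = (\<Sum>j\<in>?J. g (p j))"
    using assms(1,2) by (subst infsum_finite) (auto simp: sum.reindex inj_on_def)
  finally show ?thesis by simp
qed

lemma e_eq_iff [simp]: "e i = e j \<longleftrightarrow> i = j"
  by (auto simp: e_def fun_eq_iff split: if_splits)

lemma e_neq_0 [simp]: "e i \<noteq> 0"
  by (auto simp: e_def fun_eq_iff)

lemma minus_e_neq [simp]: "b - e j \<noteq> b"
  by (auto simp: e_def fun_eq_iff)

lemma minus_e_eq_iff [simp]: "b - e i = b - e j \<longleftrightarrow> i = j"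
  using diff_add_cancel[of b "e i"] by (metis add_diff_cancel_left' diff_add_cancel e_eq_iff)

lemma finite_F [simp]: "finite (F k b l)"
  by (simp add: F_def)

text \<open>The index 1 always belongs to \<open>F\<close>, so the maximum is taken over a nonempty
  set.\<close>

lemma xi_in_F:
  assumes "1 \<le> k" "1 \<le> j"
  shows "xi k b l j \<in> F k b l" "xi k b l j \<le> j"
proof -
  have "{i \<in> F k b l. i \<le> j} \<noteq> {}" using assms by (auto simp: F_def)
  then have "xi k b l j \<in> {i \<in> F k b l. i \<le> j}"
    unfolding xi_def by (intro Max_in) auto
  then show "xi k b l j \<in> F k b l" "xi k b l j \<le> j" by auto
qed

text \<open>The equation of the linear system at \<open>m \<in> \<F>\<close>, written without the enumeration of \<open>\<F>\<close>.\<close>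

definition balance ::
  "real \<Rightarrow> real \<Rightarrow> nat \<Rightarrow> (nat \<Rightarrow> int) \<Rightarrow> (nat \<Rightarrow> int) \<Rightarrow>
   (nat \<Rightarrow> real) \<Rightarrow> (nat \<Rightarrow> real) \<Rightarrow> (nat \<Rightarrow> real) \<Rightarrow> nat \<Rightarrow> bool" where
  "balance q t k b l r c w m \<longleftrightarrow>
     (\<Sum>j | j \<in> {1..<k} \<and> j + 1 \<in> F k b l.
        (if m = xi k b l j then r j else if m = j + 1 then c j - r j else 0) * T q t k b l j) + w m
     = S q t k b l m"

text \<open>If \<open>s\<close> enumerates \<open>F\<close>, the admissible \<open>j\<close> are the
  \<open>s ! p - 1\<close> with \<open>p \<ge> 1\<close>, and their \<open>xi\<close> is the
  preceding element \<open>s ! (p - 1)\<close>. So the sum in \<open>balance\<close> at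
  \<open>s ! i\<close> retains only \<open>p = i + 1\<close>, with coefficient \<open>r\<close>, and
  \<open>p = i\<close>, with coefficient \<open>c - r\<close>.\<close>

lemma linear_system_iff_balance:
  assumes k: "1 \<le> k"
  shows "linear_system q t k b l r c w \<longleftrightarrow> (\<forall>m\<in>F k b l. balance q t k b l r c w m)"
proof -
  define s where "s = sorted_list_of_set (F k b l)"
  define \<kappa> where "\<kappa> = card (F k b l)"
  have set: "set s = F k b l" and len: "length s = \<kappa>" by (simp_all add: s_def \<kappa>_def)
  have sorted: "sorted_wrt (<) s" unfolding s_def by (rule strict_sorted_list_of_set)
  have less: "s ! i < s ! j" if "i < j" "j < \<kappa>" for i j
    using sorted_wrt_nth_less[OF sorted] that len by auto
  have nth_eq: "s ! i = s ! j \<longleftrightarrow> i = j" if "i < \<kappa>" "j < \<kappa>" for i j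
    using less[of i j] less[of j i] that by (cases i j rule: linorder_cases) auto
  have in_F: "s ! i \<in> F k b l" if "i < \<kappa>" for i using that len set nth_mem by metis
  have F_nth: "\<exists>i<\<kappa>. m = s ! i" if "m \<in> F k b l" for m
    using that len set by (metis in_set_conv_nth)
  have "1 \<in> F k b l" using k by (simp add: F_def)
  have \<kappa>: "\<kappa> \<ge> 1" using \<open>1 \<in> F k b l\<close> unfolding \<kappa>_def by (metis One_nat_def Suc_leI card_gt_0_iff empty_iff finite_F)
  have first: "s ! 0 = 1"
  proof -
    obtain i where "i < \<kappa>" "1 = s ! i" using F_nth[OF \<open>1 \<in> F k b l\<close>] by blast
    moreover have "s ! 0 \<ge> 1" using in_F[of 0] \<kappa> by (auto simp: F_def)
    ultimately show ?thesis using less[of 0 i] by (cases "i = 0") auto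
  qed
  have ge2: "s ! i \<ge> 2" if "i \<in> {1..<\<kappa>}" for i using less[of 0 i] that first by auto
  \<comment> \<open>Positions in \<open>s\<close> start at 0, so \<open>\<iota> i\<close> is
    \<open>jF\<close> at \<open>i + 1\<close>, and \<open>\<iota> 0 = 0\<close>.\<close>
  define \<iota> where "\<iota> = (\<lambda>i. s ! i - 1)"
  have \<iota>: "\<iota> i + 1 = s ! i" "Suc (\<iota> i) = s ! i" if "i < \<kappa>" for i
    using in_F[OF that] by (auto simp: \<iota>_def F_def)
  have J: "{j. j \<in> {1..<k} \<and> j + 1 \<in> F k b l} = \<iota> ` {1..<\<kappa>}"
  proof (intro equalityI subsetI)
    fix j assume j: "j \<in> {j. j \<in> {1..<k} \<and> j + 1 \<in> F k b l}"
    then obtain i where i: "i < \<kappa>" "j + 1 = s ! i" using F_nth by blast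
    moreover have "i \<noteq> 0" using i j first by (metis Suc_eq_plus1 One_nat_def add_right_cancel atLeastLessThan_iff mem_Collect_eq not_less_eq_eq add_0 le_refl)
    ultimately show "j \<in> \<iota> ` {1..<\<kappa>}" by (intro image_eqI[of _ _ i]) (auto simp: \<iota>_def)
  next
    fix j assume "j \<in> \<iota> ` {1..<\<kappa>}"
    then obtain i where i: "i \<in> {1..<\<kappa>}" "j = \<iota> i" by blast
    then have "j + 1 = s ! i" "s ! i \<in> F k b l" "s ! i \<ge> 2" using \<iota>[of i] in_F[of i] ge2[of i] by auto
    then have "j + 1 \<in> F k b l" "1 \<le> j" by auto
    then show "j \<in> {j. j \<in> {1..<k} \<and> j + 1 \<in> F k b l}" by (auto simp: F_def)
  qed
  have inj: "inj_on \<iota> {1..<\<kappa>}"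
    using \<iota> nth_eq by (intro inj_onI) (metis atLeastLessThan_iff)
  have xi: "xi k b l (\<iota> i) = s ! (i - 1)" if i: "i \<in> {1..<\<kappa>}" for i
    unfolding xi_def
  proof (rule Max_eqI)
    have "s ! (i - 1) < s ! i" using i by (intro less) auto
    then show "s ! (i - 1) \<in> {j \<in> F k b l. j \<le> \<iota> i}" using \<iota>[of i] i in_F[of "i - 1"] by auto
    fix j assume j: "j \<in> {j \<in> F k b l. j \<le> \<iota> i}"
    then obtain i' where i': "i' < \<kappa>" "j = s ! i'" using F_nth by blast
    then have "s ! i' < s ! i" using j \<iota>[of i] i by auto
    then have "i' < i" using less[of i i'] i' nth_eq[of i i'] i by (cases i i' rule: linorder_cases) auto
    then have "i' = i - 1 \<or> i' < i - 1" "i - 1 < \<kappa>" using i by auto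
    then show "j \<le> s ! (i - 1)" using less[of i' "i - 1"] i' by auto
  qed simp
  define R where "R = (\<lambda>i. r (\<iota> i) * T q t k b l (\<iota> i))"
  define C where "C = (\<lambda>i. (c (\<iota> i) - r (\<iota> i)) * T q t k b l (\<iota> i))"
  \<comment> \<open>The boundary cases are built in: the first equation has no term
    \<open>C\<close>, the last has no term \<open>R\<close>, and for \<open>\<kappa> = 1\<close>
    both are absent.\<close>
  define E where "E = (\<lambda>i. (if i + 1 < \<kappa> then R (i + 1) else 0) + (if 1 \<le> i then C i else 0) + w (s ! i) = S q t k b l (s ! i))"
  have bal: "balance q t k b l r c w (s ! i) \<longleftrightarrow> E i" if i: "i < \<kappa>" for i
  proof -
    have "(\<Sum>j | j \<in> {1..<k} \<and> j + 1 \<in> F k b l.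
        (if s ! i = xi k b l j then r j else if s ! i = j + 1 then c j - r j else 0) * T q t k b l j) =
      (\<Sum>p\<in>{1..<\<kappa>}. (if p = i + 1 then R p else 0) + (if p = i then C p else 0))"
      unfolding J sum.reindex[OF inj] o_def
    proof (rule sum.cong[OF refl])
      fix p assume p: "p \<in> {1..<\<kappa>}"
      then have p': "p - 1 < \<kappa>" "p < \<kappa>" by auto
      have xi_iff: "s ! i = xi k b l (\<iota> p) \<longleftrightarrow> p = i + 1"
        unfolding xi[OF p] nth_eq[OF i p'(1)] using p by auto
      have p_iff: "s ! i = \<iota> p + 1 \<longleftrightarrow> p = i"
        unfolding \<iota>(1)[OF p'(2)] nth_eq[OF i p'(2)] by auto
      show "(if s ! i = xi k b l (\<iota> p) then r (\<iota> p) else if s ! i = \<iota> p + 1 then c (\<iota> p) - r (\<iota> p) else 0) * T q t k b l (\<iota> p) =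
          (if p = i + 1 then R p else 0) + (if p = i then C p else 0)"
        unfolding xi_iff p_iff by (auto simp: R_def C_def)
    qed
    also have "\<dots> = (if i + 1 < \<kappa> then R (i + 1) else 0) + (if 1 \<le> i then C i else 0)"
      using i by (simp add: sum.distrib sum.delta)
    finally show ?thesis by (simp add: balance_def E_def)
  qed
  have all: "(\<forall>m\<in>F k b l. balance q t k b l r c w m) \<longleftrightarrow> (\<forall>i<\<kappa>. E i)"
    using bal in_F F_nth by metis
  have jF: "jF k b l m = \<iota> (m - 1)" for m by (simp add: jF_def \<iota>_def s_def)
  show ?thesis
  proof (cases "\<kappa> = 1")
    case True
    then show ?thesis unfolding all linear_system_def Let_def by (simp add: \<kappa>_def[symmetric] E_def first)
  next
    case False
    then have "\<kappa> \<ge> 2" using \<kappa> by simp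
    have "linear_system q t k b l r c w \<longleftrightarrow> E 0 \<and> (\<forall>m\<in>{2..\<kappa> - 1}. E (m - 1)) \<and> E (\<kappa> - 1)"
    proof -
      have "E 0 \<longleftrightarrow> r (jF k b l 2) * T q t k b l (jF k b l 2) + w (jF k b l 1 + 1) = S q t k b l (jF k b l 1 + 1)"
        using \<open>\<kappa> \<ge> 2\<close> \<iota>[of 0] by (simp add: E_def jF R_def)
      moreover have "E (m - 1) \<longleftrightarrow> r (jF k b l (m + 1)) * T q t k b l (jF k b l (m + 1)) +
          (c (jF k b l m) - r (jF k b l m)) * T q t k b l (jF k b l m) + w (jF k b l m + 1) = S q t k b l (jF k b l m + 1)"
        if m: "m \<in> {2..\<kappa> - 1}" for m
      proof -
        have "m - 1 + 1 = m" "m < \<kappa>" "1 \<le> m - 1" "m - 1 < \<kappa>" using m by auto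
        then show ?thesis using \<iota>(1)[of "m - 1"] by (simp only: E_def jF R_def C_def if_True add_diff_cancel_right')
      qed
      moreover have "E (\<kappa> - 1) \<longleftrightarrow> (c (jF k b l \<kappa>) - r (jF k b l \<kappa>)) * T q t k b l (jF k b l \<kappa>) +
          w (jF k b l \<kappa> + 1) = S q t k b l (jF k b l \<kappa> + 1)"
      proof -
        have "\<kappa> - 1 + 1 = \<kappa>" "1 \<le> \<kappa> - 1" "\<kappa> - 1 < \<kappa>" using \<open>\<kappa> \<ge> 2\<close> by auto
        then show ?thesis using \<iota>(1)[of "\<kappa> - 1"] by (simp only: E_def jF C_def if_True less_irrefl if_False add_0)
      qed
      ultimately show ?thesis
        unfolding linear_system_def Let_def \<kappa>_def[symmetric] using False by simp
    qed
    also have "\<dots> \<longleftrightarrow> (\<forall>i<\<kappa>. E i)"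
    proof (intro iffI allI impI)
      fix i assume *: "E 0 \<and> (\<forall>m\<in>{2..\<kappa> - 1}. E (m - 1)) \<and> E (\<kappa> - 1)" "i < \<kappa>"
      consider "i = 0" | "i = \<kappa> - 1" | "i + 1 \<in> {2..\<kappa> - 1}" using *(2) by force
      then show "E i"
      proof cases
        case 3
        then have "E (i + 1 - 1)" using * by blast
        then show ?thesis by simp
      qed (use * in auto)
    qed (use \<open>\<kappa> \<ge> 2\<close> in auto)
    finally show ?thesis unfolding all .
  qed
qed

section \<open>The dynamics equation, case by case\<close>

context
  fixes q t :: real and a :: "nat \<Rightarrow> real" and k :: nat and r c w :: params
  assumes q: "0 \<le> q" "q < 1" and t: "0 \<le> t" "t < 1"
    and a: "\<And>i. i \<in> {1..k} \<Longrightarrow> a i > 0" and k: "1 \<le> k"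
begin

lemma Q_add_e:
  assumes "j \<in> {1..m}"
  shows "Q q t a m l (l + e j) = P q t a m (l + e j) / P q t a m l * psi' q t m l j"
proof -
  have "{i. i \<in> {1..m} \<and> l + e j = l + e i} = {j}" using assms by auto
  then show ?thesis by (simp add: Q_def Q_off_def)
qed

lemma Q_eq_0:
  assumes "n \<noteq> l" "\<And>j. j \<in> {1..m} \<Longrightarrow> n \<noteq> l + e j"
  shows "Q q t a m l n = 0"
proof -
  have none: "{i. i \<in> {1..m} \<and> n = l + e i} = {}" using assms by auto
  show ?thesis using assms(1) by (simp only: Q_def Q_off_def none sum.empty if_False)
qed

text \<open>By \<open>Pieri\<close> the total exit rate does not depend on \<open>l\<close>. The
  lemma is stated for all levels \<open>m \<le> k\<close> because the levels \<open>k - 1\<close>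
  and \<open>k\<close> are compared later.\<close>

lemma Q_diag:
  assumes l: "l \<in> GT m" and m: "m \<le> k"
  shows "Q q t a m l l = - (\<Sum>i\<in>{1..m}. a i)"
proof -
  have am: "\<And>i. i \<in> {1..m} \<Longrightarrow> a i > 0" using a m by auto
  have P: "P q t a m l > 0" by (rule P_pos[OF q t l am])
  have "(\<Sum>\<^sub>\<infinity>n\<in>GT m - {l}. Q_off q t a m l n) =
      (\<Sum>j | j \<in> {1..m} \<and> l + e j \<in> GT m - {l}. Q_off q t a m l (l + e j))"
    by (rule infsum_finite_support) (auto simp: inj_on_def Q_off_def intro!: sum.neutral)
  also have "\<dots> = (\<Sum>j | j \<in> {1..m} \<and> l + e j \<in> GT m - {l}. P q t a m (l + e j) / P q t a m l * psi' q t m l j)"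
    using Q_add_e[of _ m l] by (intro sum.cong) (auto simp: Q_def)
  also have "\<dots> = (\<Sum>j\<in>{1..m}. P q t a m (l + e j) / P q t a m l * psi' q t m l j)"
    by (intro sum.mono_neutral_left) (auto simp: psi'_eq_0)
  also have "\<dots> = (\<Sum>j\<in>{1..m}. P q t a m (l + e j) * psi' q t m l j) / P q t a m l"
    by (simp add: sum_divide_distrib)
  also have "\<dots> = (\<Sum>i\<in>{1..m}. a i)"
    using P by (subst Pieri[OF q t l am]) simp_all
  finally show ?thesis by (simp add: Q_def)
qed

lemma W_diag:
  assumes "interlace k b l"
  shows "W a k w l l b = - (\<Sum>m\<in>F k b l. a k * w b l m)"
proof -
  have GT: "l + e m \<in> GT k" if "m \<in> F k b l" for m
  proof -
    have "m \<in> {1..k}" using that by (simp add: F_def)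
    then show ?thesis using interlace_add_iff[OF assms] that by (auto simp: interlace_def)
  qed
  have single: "{i. i \<in> F k b l \<and> m = i} = {m}" if "m \<in> F k b l" for m
    using that by auto
  have "(\<Sum>\<^sub>\<infinity>n\<in>GT k - {l}. W_off a k w l n b) =
      (\<Sum>m | m \<in> F k b l \<and> l + e m \<in> GT k - {l}. W_off a k w l (l + e m) b)"
    by (rule infsum_finite_support) (auto simp: inj_on_def W_off_def intro!: sum.neutral)
  also have "\<dots> = (\<Sum>m\<in>F k b l. a k * w b l m)"
    using GT by (intro sum.cong) (auto simp: W_off_def assms single)
  finally show ?thesis by (simp add: W_def)
qed

text \<open>Only \<open>d = b\<close> and \<open>d = b - e j\<close> contribute, since
  \<open>Q\<close> vanishes for other predecessors of \<open>b\<close>. The factor \<open>P\<close>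
  at \<open>b - e j\<close> cancels between \<open>Lambda\<close> and \<open>Q\<close>, and the
  weight drop of 1 supplies \<open>a k\<close>, so the prefactor is the same for all
  \<open>j\<close>.\<close>

lemma sum_V:
  assumes l: "l \<in> GT k" and b: "b \<in> GT (k - 1)"
  shows "(\<Sum>\<^sub>\<infinity>d\<in>GT (k - 1). V k r c l n d b * Lambda q t a k l d * Q q t a (k - 1) d b) =
    (if n = l then Lambda q t a k l b * Q q t a (k - 1) b b else 0) +
    P q t a (k - 1) b / P q t a k l * a k powi (weight k l - weight (k - 1) b) * a k *
    (\<Sum>j\<in>{1..<k}. V k r c l n (b - e j) b * (psi q t k l (b - e j) * psi' q t (k - 1) (b - e j) j))"
proof -
  let ?g = "\<lambda>d. V k r c l n d b * Lambda q t a k l d * Q q t a (k - 1) d b"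
  \<comment> \<open>Index 0, which is not a coordinate, encodes the case that the lower signature
    rests.\<close>
  let ?p = "\<lambda>j. if j = 0 then b else b - e j"
  let ?D = "P q t a (k - 1) b / P q t a k l * a k powi (weight k l - weight (k - 1) b) * a k"
  let ?h = "\<lambda>j. V k r c l n (b - e j) b * (psi q t k l (b - e j) * psi' q t (k - 1) (b - e j) j)"
  have "(\<Sum>\<^sub>\<infinity>d\<in>GT (k - 1). ?g d) = (\<Sum>j | j \<in> {0..<k} \<and> ?p j \<in> GT (k - 1). ?g (?p j))"
  proof (rule infsum_finite_support)
    show "inj_on ?p {0..<k}" by (auto simp: inj_on_def split: if_splits)
    fix d assume d: "d \<notin> ?p ` {0..<k}"
    have "b \<noteq> d" using d k by (auto simp: image_iff)
    moreover have "b \<noteq> d + e j" if "j \<in> {1..k - 1}" for j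
    proof
      assume "b = d + e j"
      then have "d = ?p j" using that by simp
      then show False using d that by auto
    qed
    ultimately have "Q q t a (k - 1) d b = 0" by (rule Q_eq_0)
    then show "?g d = 0" by simp
  qed simp
  also have "\<dots> = (\<Sum>j\<in>{0..<k}. if ?p j \<in> GT (k - 1) then ?g (?p j) else 0)"
    by (rule sum.inter_filter) simp
  also have "{0..<k} = insert 0 {1..<k}" using k by auto
  also have "(\<Sum>j\<in>insert 0 {1..<k}. if ?p j \<in> GT (k - 1) then ?g (?p j) else 0) =
      ?g b + (\<Sum>j\<in>{1..<k}. if b - e j \<in> GT (k - 1) then ?g (b - e j) else 0)"
    using b by (subst sum.insert) (auto intro!: sum.cong)
  also have "?g b = (if n = l then Lambda q t a k l b * Q q t a (k - 1) b b else 0)"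
    by (simp add: V_def)
  also have "(\<Sum>j\<in>{1..<k}. if b - e j \<in> GT (k - 1) then ?g (b - e j) else 0) = (\<Sum>j\<in>{1..<k}. ?D * ?h j)"
  proof (rule sum.cong[OF refl])
    fix j assume "j \<in> {1..<k}"
    then have j: "j \<in> {1..k - 1}" by auto
    show "(if b - e j \<in> GT (k - 1) then ?g (b - e j) else 0) = ?D * ?h j"
    proof (cases "b - e j \<in> GT (k - 1)")
      case True
      have "P q t a (k - 1) (b - e j) > 0" by (rule P_pos[OF q t True]) (use a in auto)
      then have P: "P q t a (k - 1) (b - e j) \<noteq> 0" by simp
      have "weight (k - 1) (b - e j) = weight (k - 1) b - 1"
        using weight_add_e[OF j, of "b - e j"] by simp
      then have exponent: "weight k l - weight (k - 1) (b - e j) = weight k l - weight (k - 1) b + 1" by simp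
      have "a k powi (weight k l - weight (k - 1) (b - e j)) = a k powi (weight k l - weight (k - 1) b) * a k"
        unfolding exponent using a[of k] k by (intro power_int_add_1) simp
      then show ?thesis
        using True P Q_add_e[OF j, of "b - e j"] by (simp add: Lambda_def)
    next
      case False
      then have "\<not> interlace k (b - e j) l" by (simp add: interlace_def)
      then show ?thesis using False by (simp add: psi_eq_0)
    qed
  qed
  finally show ?thesis unfolding sum_distrib_left .
qed

lemma V_interlaced:
  assumes "interlace k b l" "j \<in> {1..<k}"
  shows "V k r c l n (b - e j) b =
    (if j + 1 \<in> F k b l then
       if n = l + e (xi k b l j) then r b l j
       else if n = l + e (j + 1) then c b l j - r b l j
       else if n = l then 1 - c b l j else 0
     else 0)"
proof -
  have "{i. i \<in> {1..k - 1} \<and> i + 1 \<in> F k b l \<and> j = i} = (if j + 1 \<in> F k b l then {j} else {})"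
    using assms(2) by auto
  then show ?thesis using assms(1) by (simp add: V_def)
qed

lemma V_not_interlaced:
  assumes "b \<in> GT (k - 1)" "l \<in> GT k" "\<not> interlace k b l" "j \<in> {1..<k}"
  shows "V k r c l n (b - e j) b = (if n = l + e j \<and> interlace k b n then 1 else 0)"
  using assms forced_iff(1)[OF assms] by (auto simp: V_def)

text \<open>Here \<open>P\<close> at \<open>l + e m\<close> cancels, and what is left carries the
  same positive prefactor as in \<open>sum_V\<close>, which can then be divided out.\<close>

lemma Q_Lambda_add_e:
  assumes m: "m \<in> {1..k}" and n: "l + e m \<in> GT k"
  shows "Q q t a k l (l + e m) * Lambda q t a k (l + e m) b =
    P q t a (k - 1) b / P q t a k l * a k powi (weight k l - weight (k - 1) b) * a k *
    (psi' q t k l m * psi q t k (l + e m) b)"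
proof -
  have "a k powi (weight k (l + e m) - weight (k - 1) b) = a k powi (weight k l - weight (k - 1) b) * a k"
    using power_int_add_1[of "a k" "weight k l - weight (k - 1) b"] a[of k] k
    by (simp add: weight_add_e[OF m] algebra_simps)
  then show ?thesis
    using P_pos[OF q t n, of a] a unfolding Q_add_e[OF m] Lambda_def by simp
qed

abbreviation dynamics_eq where
  "dynamics_eq l n b \<equiv>
    (\<Sum>\<^sub>\<infinity>d\<in>GT (k - 1). V k r c l n d b * Lambda q t a k l d * Q q t a (k - 1) d b) +
      W a k w l n b * Lambda q t a k l b = Q q t a k l n * Lambda q t a k n b"

lemma scale_pos:
  assumes "b \<in> GT (k - 1)" "l \<in> GT k"
  shows "P q t a (k - 1) b / P q t a k l * a k powi (weight k l - weight (k - 1) b) * a k > 0"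
proof -
  have "P q t a (k - 1) b > 0" by (rule P_pos[OF q t assms(1)]) (use a in auto)
  moreover have "P q t a k l > 0" by (rule P_pos[OF q t assms(2)]) (use a in auto)
  ultimately show ?thesis
    using a[of k] k by (auto intro!: mult_pos_pos divide_pos_pos zero_less_power_int)
qed

lemma dynamics_eq_add_interlaced:
  assumes il: "interlace k b l" and m: "m \<in> F k b l"
  shows "dynamics_eq l (l + e m) b \<longleftrightarrow> balance q t k b l (r b l) (c b l) (w b l) m"
proof -
  let ?D = "P q t a (k - 1) b / P q t a k l * a k powi (weight k l - weight (k - 1) b) * a k"
  have GT: "b \<in> GT (k - 1)" "l \<in> GT k" using il by (auto simp: interlace_def)
  have mk: "m \<in> {1..k}" using m by (simp add: F_def)
  then have n: "l + e m \<in> GT k" using interlace_add_iff[OF il] m by (auto simp: interlace_def)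
  have psi: "psi q t k l b > 0" by (rule psi_pos[OF q t il])
  have D: "?D > 0" by (rule scale_pos[OF GT])
  let ?v = "\<lambda>j. if m = xi k b l j then r b l j else if m = j + 1 then c b l j - r b l j else 0"
  have "(\<Sum>j\<in>{1..<k}. V k r c l (l + e m) (b - e j) b * (psi q t k l (b - e j) * psi' q t (k - 1) (b - e j) j)) =
      (\<Sum>j\<in>{1..<k}. if j + 1 \<in> F k b l then psi q t k l b * (?v j * T q t k b l j) else 0)"
    using psi by (intro sum.cong refl) (auto simp: V_interlaced[OF il] T_def)
  also have "\<dots> = psi q t k l b * (\<Sum>j | j \<in> {1..<k} \<and> j + 1 \<in> F k b l. ?v j * T q t k b l j)"
    unfolding sum.inter_filter[OF finite_atLeastLessThan] sum_distrib_left by (intro sum.cong) auto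
  finally have V: "(\<Sum>j\<in>{1..<k}. V k r c l (l + e m) (b - e j) b * (psi q t k l (b - e j) * psi' q t (k - 1) (b - e j) j)) =
      psi q t k l b * (\<Sum>j | j \<in> {1..<k} \<and> j + 1 \<in> F k b l. ?v j * T q t k b l j)" .
  have "{i. i \<in> F k b l \<and> m = i} = {m}" using m by auto
  then have W: "W a k w l (l + e m) b = a k * w b l m"
    using il by (simp add: W_def W_off_def)
  have L: "W a k w l (l + e m) b * Lambda q t a k l b = ?D * (psi q t k l b * w b l m)"
    by (simp add: W Lambda_def)
  have R: "psi' q t k l m * psi q t k (l + e m) b = psi q t k l b * S q t k b l m"
    using psi by (simp add: S_def)
  \<comment> \<open>Both sides carry the positive factor \<open>?D * psi q t k l b\<close>;
    cancelling it is an equivalence, which serves both directions of the theorem.\<close>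
  have "dynamics_eq l (l + e m) b \<longleftrightarrow>
    ?D * psi q t k l b * ((\<Sum>j | j \<in> {1..<k} \<and> j + 1 \<in> F k b l. ?v j * T q t k b l j) + w b l m) =
    ?D * psi q t k l b * S q t k b l m"
    unfolding sum_V[OF GT(2,1)] V L Q_Lambda_add_e[OF mk n] R by (simp add: algebra_simps)
  also have "\<dots> \<longleftrightarrow> balance q t k b l (r b l) (c b l) (w b l) m"
    using D psi by (simp only: balance_def mult_cancel_left) auto
  finally show ?thesis .
qed

text \<open>This case puts no condition on the parameters: \<open>W\<close> is 0, only the summand
  \<open>j = m\<close> survives with probability 1, and the rest is
  \<open>psi_forced_move_at_target\<close>.\<close>

lemma dynamics_eq_add_forced:
  assumes b: "b \<in> GT (k - 1)" and l: "l \<in> GT k" and not: "\<not> interlace k b l"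
    and il: "interlace k b (l + e m)" and m: "m \<in> {1..k}"
  shows "dynamics_eq l (l + e m) b"
proof -
  have mk: "m \<in> {1..<k}" using not_interlace_add_last[OF b l not] il m by (cases "m = k") auto
  have n: "l + e m \<in> GT k" using il by (simp add: interlace_def)
  have "(\<Sum>j\<in>{1..<k}. V k r c l (l + e m) (b - e j) b * (psi q t k l (b - e j) * psi' q t (k - 1) (b - e j) j)) =
      (\<Sum>j\<in>{1..<k}. if m = j then psi q t k l (b - e j) * psi' q t (k - 1) (b - e j) j else 0)"
    using il by (intro sum.cong refl) (auto simp: V_not_interlaced[OF b l not])
  also have "\<dots> = psi' q t k l m * psi q t k (l + e m) b"
    using mk psi_forced_move_at_target[OF q t b l not mk] by simp
  finally show ?thesis
    unfolding sum_V[OF l b] Q_Lambda_add_e[OF m n] by (simp add: W_def W_off_def not)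
qed

lemma dynamics_eq_diag:
  assumes il: "interlace k b l" and bal: "\<And>m. m \<in> F k b l \<Longrightarrow> balance q t k b l (r b l) (c b l) (w b l) m"
  shows "dynamics_eq l l b"
proof -
  let ?D = "P q t a (k - 1) b / P q t a k l * a k powi (weight k l - weight (k - 1) b) * a k"
  let ?J = "{j. j \<in> {1..<k} \<and> j + 1 \<in> F k b l}"
  let ?T = "T q t k b l"
  have GT: "b \<in> GT (k - 1)" "l \<in> GT k" using il by (auto simp: interlace_def)
  have psi: "psi q t k l b > 0" by (rule psi_pos[OF q t il])
  have L: "?D * psi q t k l b = a k * Lambda q t a k l b" by (simp add: Lambda_def)
  have "(\<Sum>j\<in>{1..<k}. V k r c l l (b - e j) b * (psi q t k l (b - e j) * psi' q t (k - 1) (b - e j) j)) =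
      (\<Sum>j\<in>{1..<k}. if j + 1 \<in> F k b l then psi q t k l b * ((1 - c b l j) * ?T j) else 0)"
    using psi by (intro sum.cong refl) (auto simp: V_interlaced[OF il] T_def)
  also have "\<dots> = psi q t k l b * (\<Sum>j\<in>?J. (1 - c b l j) * ?T j)"
    unfolding sum.inter_filter[OF finite_atLeastLessThan] sum_distrib_left by (intro sum.cong) auto
  finally have sum: "(\<Sum>j\<in>{1..<k}. V k r c l l (b - e j) b * (psi q t k l (b - e j) * psi' q t (k - 1) (b - e j) j)) =
      psi q t k l b * (\<Sum>j\<in>?J. (1 - c b l j) * ?T j)" .
  have V: "?D * (\<Sum>j\<in>{1..<k}. V k r c l l (b - e j) b * (psi q t k l (b - e j) * psi' q t (k - 1) (b - e j) j)) =
      Lambda q t a k l b * (a k * (\<Sum>j\<in>?J. (1 - c b l j) * ?T j))"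
    unfolding sum mult.assoc[symmetric, of ?D] L by (simp only: mult_ac)
  have Q1: "Q q t a (k - 1) b b = - (\<Sum>i\<in>{1..k - 1}. a i)" by (rule Q_diag[OF GT(1)]) simp
  \<comment> \<open>The exit rates of the two levels differ by \<open>a k\<close> alone, so this is
    all that remains of the diagonal entries of \<open>Q\<close>.\<close>
  have "{1..k} = insert k {1..k - 1}" using k by auto
  then have Q2: "Q q t a k l l = - (\<Sum>i\<in>{1..k - 1}. a i) - a k"
    unfolding Q_diag[OF GT(2) order_refl] using k by simp
  have "(\<Sum>m\<in>F k b l. S q t k b l m) = (\<Sum>m\<in>F k b l. (\<Sum>j\<in>?J. (if m = xi k b l j then r b l j else if m = j + 1 then c b l j - r b l j else 0) * ?T j) + w b l m)"
    using bal by (intro sum.cong refl) (simp add: balance_def)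
  also have "\<dots> = (\<Sum>j\<in>?J. (\<Sum>m\<in>F k b l. if m = xi k b l j then r b l j else if m = j + 1 then c b l j - r b l j else 0) * ?T j) + (\<Sum>m\<in>F k b l. w b l m)"
    unfolding sum.distrib sum_distrib_right by (subst sum.swap) simp
  \<comment> \<open>For each \<open>j\<close> the targets \<open>xi k b l j\<close> and
    \<open>j + 1\<close> are distinct elements of \<open>F\<close>, so their coefficients add up to
    \<open>c\<close>.\<close>
  also have "(\<Sum>j\<in>?J. (\<Sum>m\<in>F k b l. if m = xi k b l j then r b l j else if m = j + 1 then c b l j - r b l j else 0) * ?T j) = (\<Sum>j\<in>?J. c b l j * ?T j)"
  proof (rule sum.cong[OF refl])
    fix j assume j: "j \<in> ?J"
    have xi: "xi k b l j \<in> F k b l" "xi k b l j \<noteq> j + 1" using xi_in_F[OF k, of j b l] j by auto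
    have "(\<Sum>m\<in>F k b l. if m = xi k b l j then r b l j else if m = j + 1 then c b l j - r b l j else 0) =
        (\<Sum>m\<in>F k b l. (if m = xi k b l j then r b l j else 0) + (if m = j + 1 then c b l j - r b l j else 0))"
      using xi by (intro sum.cong) auto
    also have "\<dots> = c b l j"
      using xi j by (simp add: sum.distrib)
    finally show "(\<Sum>m\<in>F k b l. if m = xi k b l j then r b l j else if m = j + 1 then c b l j - r b l j else 0) * ?T j = c b l j * ?T j"
      by simp
  qed
  finally have "1 + (\<Sum>j\<in>?J. ?T j) = (\<Sum>j\<in>?J. c b l j * ?T j) + (\<Sum>m\<in>F k b l. w b l m)"
    unfolding sum_S[OF q t il k] .
  then have key: "(\<Sum>j\<in>?J. (1 - c b l j) * ?T j) = (\<Sum>m\<in>F k b l. w b l m) - 1"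
    by (simp add: left_diff_distrib sum_subtractf)
  show ?thesis
    unfolding sum_V[OF GT(2,1)] V key W_diag[OF il] Q1 Q2
    by (simp add: sum_distrib_left[symmetric] algebra_simps)
qed

text \<open>Such an \<open>n\<close> is not reachable in one jump, so \<open>V\<close>,
  \<open>W\<close> and \<open>Q\<close> all vanish; \<open>n \<noteq> l\<close> also removes the
  term with resting \<open>b\<close>.\<close>

lemma dynamics_eq_far:
  assumes b: "b \<in> GT (k - 1)" and l: "l \<in> GT k"
    and n: "n \<noteq> l" "\<And>m. m \<in> {1..k} \<Longrightarrow> n \<noteq> l + e m"
  shows "dynamics_eq l n b"
proof -
  have V: "V k r c l n (b - e j) b = 0" if j: "j \<in> {1..<k}" for j
  proof (cases "interlace k b l")
    case True
    have "xi k b l j \<in> {1..k}" using xi_in_F[OF k, of j b l] j by (auto simp: F_def)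
    then show ?thesis using n j by (simp add: V_interlaced[OF True j])
  next
    case False
    then show ?thesis using n j by (simp add: V_not_interlaced[OF b l False j])
  qed
  have none: "{m. m \<in> F k b l \<and> n = l + e m} = {}" using n(2) by (auto simp: F_def)
  have "W a k w l n b = 0" using n(1) by (simp only: W_def W_off_def none sum.empty if_False if_cancel)
  then show ?thesis
    unfolding sum_V[OF l b] using n V Q_eq_0[OF n] by simp
qed

text \<open>Necessity uses only the targets \<open>l + e m\<close> with \<open>m\<close> in
  \<open>F\<close>. For sufficiency the target \<open>l\<close> follows from these equations, and
  forced or unreachable targets give identities.\<close>

lemma is_dynamics_iff:
  "is_dynamics q t a k r c w \<longleftrightarrow>
    (\<forall>b l. interlace k b l \<longrightarrow> linear_system q t k b l (r b l) (c b l) (w b l))"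
proof (intro iffI allI impI)
  fix b l assume dyn: "is_dynamics q t a k r c w" and il: "interlace k b l"
  have "balance q t k b l (r b l) (c b l) (w b l) m" if m: "m \<in> F k b l" for m
  proof -
    have "m \<in> {1..k}" using m by (simp add: F_def)
    then have "interlace k b (l + e m)" using interlace_add_iff[OF il] m by blast
    then have "dynamics_eq l (l + e m) b" using dyn il unfolding is_dynamics_def interlace_def by blast
    then show ?thesis using dynamics_eq_add_interlaced[OF il m] by blast
  qed
  then show "linear_system q t k b l (r b l) (c b l) (w b l)"
    using linear_system_iff_balance[OF k] by blast
next
  assume sys: "\<forall>b l. interlace k b l \<longrightarrow> linear_system q t k b l (r b l) (c b l) (w b l)"
  have bal: "balance q t k b l (r b l) (c b l) (w b l) m" if "interlace k b l" "m \<in> F k b l" for b l m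
    using that sys linear_system_iff_balance[OF k] by blast
  show "is_dynamics q t a k r c w"
    unfolding is_dynamics_def
  proof (intro ballI impI)
    fix l n b assume l: "l \<in> GT k" and n: "n \<in> GT k" and b: "b \<in> GT (k - 1)" and il: "interlace k b n"
    consider "n = l" | m where "m \<in> {1..k}" "n = l + e m" | "n \<noteq> l" "\<And>m. m \<in> {1..k} \<Longrightarrow> n \<noteq> l + e m"
      by blast
    then show "dynamics_eq l n b"
    proof cases
      case 1
      then show ?thesis using dynamics_eq_diag bal il by blast
    next
      case 2
      show ?thesis
      proof (cases "interlace k b l")
        case True
        then have "m \<in> F k b l" using interlace_add_iff 2 il by blast
        then show ?thesis using dynamics_eq_add_interlaced[OF True] bal[OF True] 2 by blast
      next
        case False
        then show ?thesis using dynamics_eq_add_forced[OF b l] 2 il by blast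
      qed
    next
      case 3
      then show ?thesis by (rule dynamics_eq_far[OF b l])
    qed
  qed
qed

end

theorem proposition6p2:
  fixes q t :: real and a :: "nat \<Rightarrow> real" and N k :: nat and r c w :: params
  assumes "0 \<le> q" "q < 1" "0 \<le> t" "t < 1"
    and "\<And>i. i \<in> {1..N} \<Longrightarrow> a i > 0"
    and "2 \<le> k" "k \<le> N"
  shows "is_dynamics q t a k r c w \<longleftrightarrow>
    (\<forall>nb l. interlace k nb l \<longrightarrow>
       linear_system q t k nb l (r nb l) (c nb l) (w nb l))"
  using assms by (intro is_dynamics_iff) auto

end
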